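(* Let $k$ be a field of characteristic $0$ and $(A,\phi)$ a dga over $k$. Let ${}_1E$ be the spectral sequence of the filtration $$F_1^s\,\mathcal T(EC(A))^n=\bigoplus_{\substack{p+q+r=n\\ p\ge s}}EC(A)^{p,q,r},$$ which has ${}_1E_2^{p,q}\simeq H^p(\Delta_-^qHH^*_{dg}(A))$ and converges to $HC^{p+q}_{dg}(A)$. If ${}_1E$ degenerates at the $E_2$ page, then there is a surjection $$HC^n_{dg}(A)\to\ker\big(HH^n_{dg}(A)\to HH^{n-1}_{dg}(A)\big)$$ for all $n\ge 1$, where $HH^n_{dg}(A)\to HH^{n-1}_{dg}(A)$ is the map induced by $B$.
   Context: **Dgas.** A dga $(A,\phi)$ over $k$ is a unital associative graded $k$-algebra $A=\bigoplus_{m\ge 0}A^m$ with a $k$-linear map $\phi$ lowering degree by one such that $\phi^2=0$ and $\phi(xy)=\phi(x)y+(-1)^{|x|}x\phi(y)$, where $|x|$ is the degree of a homogeneous element. $(A^{\otimes n})^m$ is the total-degree-$m$ part of $A^{\otimes n}$, and $\phi^{\otimes n}$ denotes the induced differential $\phi^{\otimes n}(a_1\otimes\dots\otimes a_n)=\sum_i(-1)^{|a_1|+\dots+|a_{i-1}|}a_1\otimes\dots\otimes\phi(a_i)\otimes\dots\otimes a_n$. For $n,m\ge 0$ put $C^n(A)^m=\mathrm{Hom}_k((A^{\otimes n+1})^m,k)$. **Operators** (on homogeneous $a_i$, with $\gamma_n=|a_n|(|a_0|+\dots+|a_{n-1}|)$): - $\delta:C^n(A)^m\to C^n(A)^{m+1}$,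 $\delta f=(-1)^m f\circ\phi^{\otimes n+1}$. - $b:C^{n-1}(A)^m\to C^n(A)^m$, $b(f)(a_0\otimes\dots\otimes a_n)=\sum_{i=0}^{n-1}(-1)^i f(a_0\otimes\dots\otimes a_ia_{i+1}\otimes\dots\otimes a_n)+(-1)^{n+\gamma_n}f(a_na_0\otimes a_1\otimes\dots\otimes a_{n-1})$. - $\tau:C^n(A)^m\to C^n(A)^m$, $\tau(f)(a_0\otimes\dots\otimes a_n)=(-1)^{n+\gamma_n}f(a_n\otimes a_0\otimes\dots\otimes a_{n-1})$; $N=\sum_{i=0}^n\tau^i$ on $C^n(A)^m$. - $s:C^{n+1}(A)^m\to C^n(A)^m$, $s(f)(a_0\otimes\dots\otimes a_n)=(-1)^n f(a_0\otimes\dots\otimes a_n\otimes 1)$. - $B=Ns(\mathbf 1-\tau):C^{n+1}(A)^m\to C^n(A)^m$ (and $B=0$ on $C^0(A)^m$). **Hochschild cohomology.** $\mathcal T(EH(A))^n=\bigoplus_{p+q=n}C^p(A)^q$ with differential $b+(-1)^p\delta$ on $C^p(A)^q$; $HH^n_{dg}(A)=H^n(\mathcal T(EH(A)))$. The operator $B$ anticommutes with this differential and so induces maps $HH^n_{dg}(A)\to HH^{n-1}_{dg}(A)$. **Cyclic cohomology.** $EC(A)$ is the tricomplex with $EC(A)^{p,q,r}=C^{q-p}(A)^r$ for $0\le p\le q$, $r\ge 0$, and $0$ otherwise. $\mathcal T(EC(A))^n=\bigoplus_{p+q+r=n}EC(A)^{p,q,r}$ has differential $b+B+(-1)^{q-p}\delta$,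 where $b$ raises $q$, $B$ raises $p$, $\delta$ raises $r$ by one. $HC^n_{dg}(A)=H^n(\mathcal T(EC(A)))$. **Truncation.** $\Delta_-^qHH^*_{dg}(A)$ is the cochain complex $HH^q_{dg}(A)\to HH^{q-1}_{dg}(A)\to\dots\to HH^0_{dg}(A)\to 0$, with $HH^{q-n}_{dg}(A)$ in degree $n$ for $0\le n\le q$, and differential induced by $B$. **Degeneration.** The spectral sequence degenerates at $E_2$ if all differentials $d_r$ with $r\ge 2$ vanish (so $E_2=E_\infty$). *)

theory Defs
  imports
    Complex_Main
    "HOL-Library.Poly_Mapping"
    "HOL-Library.Set_Algebras"
    "HOL-Library.Function_Algebras"
    "HOL-Library.FuncSet"
begin

section \<open>Subquotients of vector spaces\<close>

text \<open>
  Vector spaces that are quotients are represented by their cosets inside an ambient type: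
  \<open>quot W D\<close> is the image of \<open>W\<close> in the quotient by the subspace \<open>D\<close>. Cosets are added
  elementwise, by \<open>+\<close> from \<^theory>\<open>HOL-Library.Set_Algebras\<close>. Adding \<open>D\<close> in the scalar
  multiplication only matters for the scalar \<open>0\<close>. The zero vector of \<open>quot W D\<close> is \<open>D\<close>.
\<close>

definition quot :: "'v::ab_group_add set \<Rightarrow> 'v set \<Rightarrow> 'v set set" where
  "quot W D = (\<lambda>x. x +o D) ` W"

definition quot_scale :: "('k \<Rightarrow> 'v::ab_group_add \<Rightarrow> 'v) \<Rightarrow> 'v set \<Rightarrow> 'k \<Rightarrow> 'v set \<Rightarrow> 'v set" where
  "quot_scale s D c X = s c ` X + D"

text \<open>
  \<open>quot_linear s1 D1 Q1 s2 D2 Q2 F\<close>: the map \<open>F\<close> is linear from the space \<open>Q1\<close> of cosets of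
  \<open>D1\<close> to the space \<open>Q2\<close> of cosets of \<open>D2\<close>, where \<open>s1\<close> and \<open>s2\<close> are the scalar
  multiplications of the ambient types.
\<close>

definition quot_linear ::
  "('k \<Rightarrow> 'v::ab_group_add \<Rightarrow> 'v) \<Rightarrow> 'v set \<Rightarrow> 'v set set \<Rightarrow>
   ('k \<Rightarrow> 'w::ab_group_add \<Rightarrow> 'w) \<Rightarrow> 'w set \<Rightarrow> 'w set set \<Rightarrow> ('v set \<Rightarrow> 'w set) \<Rightarrow> bool" where
  "quot_linear s1 D1 Q1 s2 D2 Q2 F \<longleftrightarrow>
     (\<forall>X\<in>Q1. F X \<in> Q2) \<and>
     (\<forall>X\<in>Q1. \<forall>Y\<in>Q1. F (X + Y) = F X + F Y) \<and>
     (\<forall>c. \<forall>X\<in>Q1. F (quot_scale s1 D1 c X) = quot_scale s2 D2 c (F X))"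


section \<open>Cochain complexes and the spectral sequence of a filtration\<close>

text \<open>
  A cochain complex is a family \<open>V n\<close> of subspaces of an ambient type together with one map
  \<open>d\<close> that sends each \<open>V n\<close> to \<open>V (n + 1)\<close>.
\<close>

definition cocycles :: "(int \<Rightarrow> 'v::ab_group_add set) \<Rightarrow> ('v \<Rightarrow> 'v) \<Rightarrow> int \<Rightarrow> 'v set" where
  "cocycles V d n = {x \<in> V n. d x = 0}"

definition coboundaries :: "(int \<Rightarrow> 'v::ab_group_add set) \<Rightarrow> ('v \<Rightarrow> 'v) \<Rightarrow> int \<Rightarrow> 'v set" where
  "coboundaries V d n = d ` V (n - 1)"

definition cohomology :: "(int \<Rightarrow> 'v::ab_group_add set) \<Rightarrow> ('v \<Rightarrow> 'v) \<Rightarrow> int \<Rightarrow> 'v set set" where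
  "cohomology V d n = quot (cocycles V d n) (coboundaries V d n)"

text \<open>
  For a decreasing filtration \<open>F s n\<close> (filtration index \<open>s\<close>, degree \<open>n\<close>) of a complex with
  differential \<open>d\<close>, put
  \<open>Z\<^sub>r\<^sup>s = {x \<in> F\<^sup>s. d x \<in> F\<^sup>s\<^sup>+\<^sup>r}\<close> and
  \<open>E\<^sub>r\<^sup>s = Z\<^sub>r\<^sup>s / (Z\<^sub>r\<^sub>-\<^sub>1\<^sup>s\<^sup>+\<^sup>1 + d Z\<^sub>r\<^sub>-\<^sub>1\<^sup>s\<^sup>-\<^sup>r\<^sup>+\<^sup>1)\<close>.
  The bidegree \<open>(s, t)\<close> of the spectral sequence lies in total degree \<open>n = s + t\<close>, and
  \<open>ss_diff\<close> is the differential \<open>d\<^sub>r\<close> from bidegree \<open>(s, t)\<close> to \<open>(s + r, t - r + 1)\<close>: it sends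
  the class of \<open>x\<close> to the class of \<open>d x\<close>.
\<close>

definition ss_Z :: "(int \<Rightarrow> int \<Rightarrow> 'v::ab_group_add set) \<Rightarrow> ('v \<Rightarrow> 'v) \<Rightarrow> int \<Rightarrow> int \<Rightarrow> int \<Rightarrow> 'v set" where
  "ss_Z F d r s n = {x \<in> F s n. d x \<in> F (s + r) (n + 1)}"

definition ss_B :: "(int \<Rightarrow> int \<Rightarrow> 'v::ab_group_add set) \<Rightarrow> ('v \<Rightarrow> 'v) \<Rightarrow> int \<Rightarrow> int \<Rightarrow> int \<Rightarrow> 'v set" where
  "ss_B F d r s n = ss_Z F d (r - 1) (s + 1) n + d ` ss_Z F d (r - 1) (s - r + 1) (n - 1)"

definition ss_E :: "(int \<Rightarrow> int \<Rightarrow> 'v::ab_group_add set) \<Rightarrow> ('v \<Rightarrow> 'v) \<Rightarrow> int \<Rightarrow> int \<Rightarrow> int \<Rightarrow> 'v set set" where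
  "ss_E F d r s t = quot (ss_Z F d r s (s + t)) (ss_B F d r s (s + t))"

definition ss_diff ::
  "(int \<Rightarrow> int \<Rightarrow> 'v::ab_group_add set) \<Rightarrow> ('v \<Rightarrow> 'v) \<Rightarrow> int \<Rightarrow> int \<Rightarrow> int \<Rightarrow> 'v set \<Rightarrow> 'v set" where
  "ss_diff F d r s t X = d ` X + ss_B F d r (s + r) (s + t + 1)"

definition ss_degenerates_at ::
  "(int \<Rightarrow> int \<Rightarrow> 'v::ab_group_add set) \<Rightarrow> ('v \<Rightarrow> 'v) \<Rightarrow> int \<Rightarrow> bool" where
  "ss_degenerates_at F d r0 \<longleftrightarrow>
     (\<forall>r\<ge>r0. \<forall>s t. \<forall>X \<in> ss_E F d r s t. ss_diff F d r s t X = ss_B F d r (s + r) (s + t + 1))"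


section \<open>Dgas\<close>

text \<open>
  The sort \<open>{ring, monoid_mult}\<close> is that of unital rings; unlike \<open>ring_1\<close> it does not
  exclude the zero ring. The degree \<open>m\<close> part of the algebra is \<open>A m\<close>.
\<close>

locale dga = vector_space scale
  for scale :: "'k::field_char_0 \<Rightarrow> 'a::{ring, monoid_mult} \<Rightarrow> 'a" +
  fixes A :: "nat \<Rightarrow> 'a set" and \<phi> :: "'a \<Rightarrow> 'a"
  assumes scale_mult_left: "scale c x * y = scale c (x * y)"
    and scale_mult_right: "x * scale c y = scale c (x * y)"
    and subspace_A: "subspace (A m)"
    and direct_sum_A: "\<exists>!f :: nat \<Rightarrow> 'a. (\<forall>m. f m \<in> A m) \<and> finite {m. f m \<noteq> 0} \<and> x = (\<Sum>m | f m \<noteq> 0. f m)"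
    and mult_A: "x \<in> A m \<Longrightarrow> y \<in> A n \<Longrightarrow> x * y \<in> A (m + n)"
    and linear_\<phi>: "Vector_Spaces.linear scale scale \<phi>"
    and \<phi>_A_0: "x \<in> A 0 \<Longrightarrow> \<phi> x = 0"
    and \<phi>_A_Suc: "x \<in> A (Suc m) \<Longrightarrow> \<phi> x \<in> A m"
    and \<phi>_\<phi>: "\<phi> (\<phi> x) = 0"
    and leibniz: "x \<in> A m \<Longrightarrow> \<phi> (x * y) = \<phi> x * y + scale ((-1) ^ m) (x * \<phi> y)"


section \<open>Tensor powers and cochains\<close>

text \<open>The free vector space on lists: \<open>Poly_Mapping.single as 1\<close> is the basis vector of the list \<open>as\<close>.\<close>

definition free_scale :: "'k::field \<Rightarrow> ('a list \<Rightarrow>\<^sub>0 'k) \<Rightarrow> ('a list \<Rightarrow>\<^sub>0 'k)" where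
  "free_scale c = Poly_Mapping.map ((*) c)"

lemma lookup_free_scale: "Poly_Mapping.lookup (free_scale c x) as = c * Poly_Mapping.lookup x as"
  by (simp add: free_scale_def Poly_Mapping.map.rep_eq when_def)

interpretation free: vector_space "free_scale :: 'k::field \<Rightarrow> ('a list \<Rightarrow>\<^sub>0 'k) \<Rightarrow> ('a list \<Rightarrow>\<^sub>0 'k)"
  by standard
    (simp_all add: poly_mapping_eq_iff fun_eq_iff lookup_free_scale lookup_add algebra_simps)

type_synonym ('k, 'a) tensor = "('a list \<Rightarrow>\<^sub>0 'k) set"
type_synonym ('k, 'a) cochain = "('k, 'a) tensor \<Rightarrow> 'k"

context dga
begin

text \<open>\<open>tensor_rel n\<close> is spanned by the multilinearity relations in the lists of length \<open>n\<close>.\<close>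

definition tensor_rel :: "nat \<Rightarrow> ('a list \<Rightarrow>\<^sub>0 'k) set" where
  "tensor_rel n = free.span
     ({Poly_Mapping.single (xs @ (u + v) # ys) 1
         - Poly_Mapping.single (xs @ u # ys) 1 - Poly_Mapping.single (xs @ v # ys) 1
       | xs u v ys. length xs + length ys + 1 = n} \<union>
      {Poly_Mapping.single (xs @ scale c u # ys) 1 - Poly_Mapping.single (xs @ u # ys) c
       | xs c u ys. length xs + length ys + 1 = n})"

definition elem_tensor :: "'a list \<Rightarrow> ('k, 'a) tensor" where
  "elem_tensor as = Poly_Mapping.single as 1 +o tensor_rel (length as)"

text \<open>\<open>homog ds as\<close>: each \<open>as ! i\<close> is homogeneous of degree \<open>ds ! i\<close>.\<close>

definition homog :: "nat list \<Rightarrow> 'a list \<Rightarrow> bool" where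
  "homog ds as \<longleftrightarrow> list_all2 (\<lambda>d a. a \<in> A d) ds as"

definition tensor_pow :: "nat \<Rightarrow> ('k, 'a) tensor set" where
  "tensor_pow n = quot (free.span {Poly_Mapping.single as 1 | as. length as = n}) (tensor_rel n)"

definition tensor_pow_deg :: "nat \<Rightarrow> nat \<Rightarrow> ('k, 'a) tensor set" where
  "tensor_pow_deg n m =
     quot (free.span {Poly_Mapping.single as 1 | as ds. length as = n \<and> homog ds as \<and> sum_list ds = m})
       (tensor_rel n)"

text \<open>
  The differential \<open>\<phi>\<^sup>\<otimes>\<^sup>n\<close>: the linear map on \<open>tensor_pow n\<close> with the given values on the
  tensors of homogeneous elements. The sum over \<open>i\<close> is written in the free vector space.
\<close>

definition tensor_diff :: "nat \<Rightarrow> ('k, 'a) tensor \<Rightarrow> ('k, 'a) tensor" where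
  "tensor_diff n = (THE D. D \<in> extensional (tensor_pow n) \<and>
     quot_linear free_scale (tensor_rel n) (tensor_pow n) free_scale (tensor_rel n) (tensor_pow n) D \<and>
     (\<forall>ds as. length as = n \<and> homog ds as \<longrightarrow>
        D (elem_tensor as) =
          (\<Sum>i<n. Poly_Mapping.single (as[i := \<phi> (as ! i)]) ((-1) ^ sum_list (take i ds))) +o tensor_rel n))"

text \<open>
  \<open>C n m\<close> consists of the linear functionals on the degree \<open>m\<close> part of the tensor power with
  \<open>n + 1\<close> factors, extended by \<open>0\<close> to the rest of the type.
\<close>

definition C :: "nat \<Rightarrow> nat \<Rightarrow> ('k, 'a) cochain set" where
  "C n m = {f.
     (\<forall>X\<in>tensor_pow_deg (n + 1) m. \<forall>Y\<in>tensor_pow_deg (n + 1) m. f (X + Y) = f X + f Y) \<and>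
     (\<forall>c. \<forall>X\<in>tensor_pow_deg (n + 1) m. f (quot_scale free_scale (tensor_rel (n + 1)) c X) = c * f X) \<and>
     (\<forall>X. X \<notin> tensor_pow_deg (n + 1) m \<longrightarrow> f X = 0)}"

text \<open>
  The element of \<open>C n m\<close> with value \<open>v ds as\<close> on the tensor of the homogeneous elements \<open>as\<close>
  of degrees \<open>ds\<close>. The entry \<open>0\<close> has every degree; all \<open>v\<close> used below vanish on lists that
  contain it.
\<close>

definition cochain_of :: "nat \<Rightarrow> nat \<Rightarrow> (nat list \<Rightarrow> 'a list \<Rightarrow> 'k) \<Rightarrow> ('k, 'a) cochain" where
  "cochain_of n m v = (THE g. g \<in> C n m \<and>
     (\<forall>ds as. length as = n + 1 \<and> homog ds as \<and> sum_list ds = m \<longrightarrow> g (elem_tensor as) = v ds as))"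


section \<open>The operators\<close>

text \<open>
  The pair of numbers in front of the cochain gives the bidegree \<open>(n, m)\<close> of the result,
  except for \<open>op_delta n m\<close>, which maps \<open>C n m\<close> to \<open>C n (m + 1)\<close>.
\<close>

definition gam :: "nat \<Rightarrow> nat list \<Rightarrow> nat" where
  "gam n ds = ds ! n * sum_list (take n ds)"

definition op_delta :: "nat \<Rightarrow> nat \<Rightarrow> ('k, 'a) cochain \<Rightarrow> ('k, 'a) cochain" where
  "op_delta n m f = (\<lambda>X. if X \<in> tensor_pow_deg (n + 1) (m + 1)
     then (-1) ^ m * f (tensor_diff (n + 1) X) else 0)"

definition op_b :: "nat \<Rightarrow> nat \<Rightarrow> ('k, 'a) cochain \<Rightarrow> ('k, 'a) cochain" where
  "op_b n m f = cochain_of n m (\<lambda>ds as.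
     (\<Sum>i<n. (-1) ^ i * f (elem_tensor (take i as @ (as ! i * as ! (i + 1)) # drop (i + 2) as)))
     + (-1) ^ (n + gam n ds) * f (elem_tensor ((as ! n * as ! 0) # butlast (tl as))))"

definition op_tau :: "nat \<Rightarrow> nat \<Rightarrow> ('k, 'a) cochain \<Rightarrow> ('k, 'a) cochain" where
  "op_tau n m f = cochain_of n m (\<lambda>ds as.
     (-1) ^ (n + gam n ds) * f (elem_tensor (last as # butlast as)))"

definition op_N :: "nat \<Rightarrow> nat \<Rightarrow> ('k, 'a) cochain \<Rightarrow> ('k, 'a) cochain" where
  "op_N n m f = (\<Sum>i\<le>n. (op_tau n m ^^ i) f)"

definition op_s :: "nat \<Rightarrow> nat \<Rightarrow> ('k, 'a) cochain \<Rightarrow> ('k, 'a) cochain" where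
  "op_s n m f = cochain_of n m (\<lambda>ds as. (-1) ^ n * f (elem_tensor (as @ [1])))"

definition op_B :: "nat \<Rightarrow> nat \<Rightarrow> ('k, 'a) cochain \<Rightarrow> ('k, 'a) cochain" where
  "op_B n m f = op_N n m (op_s n m (f - op_tau (n + 1) m f))"


section \<open>Hochschild cohomology\<close>

text \<open>
  An element of the total complex is the family of its components \<open>f p q\<close>. Only finitely many
  of the bidegrees have total degree \<open>n\<close>, so that these families form the direct sum.
\<close>

definition T_EH :: "int \<Rightarrow> (nat \<Rightarrow> nat \<Rightarrow> ('k, 'a) cochain) set" where
  "T_EH n = {f. \<forall>p q. f p q \<in> C p q \<and> (int (p + q) \<noteq> n \<longrightarrow> f p q = 0)}"

definition EH_scale :: "'k \<Rightarrow> (nat \<Rightarrow> nat \<Rightarrow> ('k, 'a) cochain) \<Rightarrow> (nat \<Rightarrow> nat \<Rightarrow> ('k, 'a) cochain)" where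
  "EH_scale c f = (\<lambda>p q X. c * f p q X)"

definition d_EH :: "(nat \<Rightarrow> nat \<Rightarrow> ('k, 'a) cochain) \<Rightarrow> (nat \<Rightarrow> nat \<Rightarrow> ('k, 'a) cochain)" where
  "d_EH f = (\<lambda>p q.
     (if 0 < p then op_b p q (f (p - 1) q) else 0)
     + (if 0 < q then (\<lambda>X. (-1) ^ p * op_delta p (q - 1) (f p (q - 1)) X) else 0))"

definition HH :: "int \<Rightarrow> (nat \<Rightarrow> nat \<Rightarrow> ('k, 'a) cochain) set set" where
  "HH n = cohomology T_EH d_EH n"

definition B_EH :: "(nat \<Rightarrow> nat \<Rightarrow> ('k, 'a) cochain) \<Rightarrow> (nat \<Rightarrow> nat \<Rightarrow> ('k, 'a) cochain)" where
  "B_EH f = (\<lambda>p q. op_B p q (f (p + 1) q))"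

text \<open>The map from \<open>HH n\<close> to \<open>HH (n - 1)\<close> that sends the class of \<open>x\<close> to the class of \<open>B x\<close>.\<close>

definition B_HH :: "int \<Rightarrow> (nat \<Rightarrow> nat \<Rightarrow> ('k, 'a) cochain) set \<Rightarrow> (nat \<Rightarrow> nat \<Rightarrow> ('k, 'a) cochain) set" where
  "B_HH n X = B_EH ` X + coboundaries T_EH d_EH (n - 1)"

definition ker_B_HH :: "int \<Rightarrow> (nat \<Rightarrow> nat \<Rightarrow> ('k, 'a) cochain) set set" where
  "ker_B_HH n = {X \<in> HH n. B_HH n X = coboundaries T_EH d_EH (n - 1)}"


section \<open>Cyclic cohomology\<close>

definition EC :: "nat \<Rightarrow> nat \<Rightarrow> nat \<Rightarrow> ('k, 'a) cochain set" where
  "EC p q r = (if p \<le> q then C (q - p) r else {0})"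

definition T_EC :: "int \<Rightarrow> (nat \<Rightarrow> nat \<Rightarrow> nat \<Rightarrow> ('k, 'a) cochain) set" where
  "T_EC n = {f. \<forall>p q r. f p q r \<in> EC p q r \<and> (int (p + q + r) \<noteq> n \<longrightarrow> f p q r = 0)}"

definition EC_scale ::
  "'k \<Rightarrow> (nat \<Rightarrow> nat \<Rightarrow> nat \<Rightarrow> ('k, 'a) cochain) \<Rightarrow> (nat \<Rightarrow> nat \<Rightarrow> nat \<Rightarrow> ('k, 'a) cochain)" where
  "EC_scale c f = (\<lambda>p q r X. c * f p q r X)"

definition d_EC ::
  "(nat \<Rightarrow> nat \<Rightarrow> nat \<Rightarrow> ('k, 'a) cochain) \<Rightarrow> (nat \<Rightarrow> nat \<Rightarrow> nat \<Rightarrow> ('k, 'a) cochain)" where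
  "d_EC f = (\<lambda>p q r.
     (if p < q then op_b (q - p) r (f p (q - 1) r) else 0)
     + (if 0 < p \<and> p \<le> q then op_B (q - p) r (f (p - 1) q r) else 0)
     + (if p \<le> q \<and> 0 < r then (\<lambda>X. (-1) ^ (q - p) * op_delta (q - p) (r - 1) (f p q (r - 1)) X) else 0))"

definition HC :: "int \<Rightarrow> (nat \<Rightarrow> nat \<Rightarrow> nat \<Rightarrow> ('k, 'a) cochain) set set" where
  "HC n = cohomology T_EC d_EC n"

definition F1 :: "int \<Rightarrow> int \<Rightarrow> (nat \<Rightarrow> nat \<Rightarrow> nat \<Rightarrow> ('k, 'a) cochain) set" where
  "F1 s n = {f \<in> T_EC n. \<forall>p q r. int p < s \<longrightarrow> f p q r = 0}"

end

end

theory Submission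
  imports Defs
begin

text \<open>
  The surjection is induced by projecting a cochain of the cyclic complex to its components in
  filtration degree \<open>p = 0\<close>. The columns of the tricomplex are shifted copies of the Hochschild
  complex, and the total differential is the Hochschild differential \<open>d\<close> within each column plus
  \<open>B\<close> from each column to the next (\<open>column_d_EC\<close>). For a cocycle \<open>(f\<^sub>0, f\<^sub>1, \<dots>)\<close> this
  says \<open>d f\<^sub>0 = 0\<close> and \<open>B f\<^sub>0 = - d f\<^sub>1\<close>, so the class of \<open>f\<^sub>0\<close> lies in the kernel of the
  map that \<open>B\<close> induces on Hochschild cohomology (\<open>column_0_cocycle\<close>).

  Surjectivity is where degeneration enters (\<open>extend_to_cocycle\<close>). If \<open>d f = 0\<close> and
  \<open>B f = d g\<close>, then \<open>(f, - g, 0, \<dots>)\<close> has a differential of filtration degree \<open>2\<close>, and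
  therefore represents an element of the second page. As \<open>d\<^sub>2\<close> vanishes, it can be changed in
  positive filtration degree so that its differential has filtration degree \<open>3\<close>, and so on
  (\<open>ss_lift\<close>). The filtration is finite in each degree, so that after finitely many steps
  the differential is \<open>0\<close>; the component \<open>f\<close> in filtration degree \<open>0\<close> never changes.

  The kernel on cohomology only makes sense because \<open>B\<close> maps coboundaries to coboundaries, that
  is, because it anticommutes with \<open>d\<close> (\<open>B_EH_d_EH\<close>). This is the longest part. Connes'
  operator is \<open>B = N s (1 - \<tau>)\<close>, and with \<open>b'\<close> denoting \<open>b\<close> without its cyclic summand one
  has \<open>(1 - \<tau>) b = b' (1 - \<tau>)\<close>, \<open>N b' = b N\<close>, \<open>s b' + b' s = 1\<close> and \<open>N (1 - \<tau>) = 0\<close>. The first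
  two identities follow formally from relations between \<open>\<tau>\<close> and the single summands of \<open>b\<close>. All
  of them are verified on values at tensors of homogeneous elements, where the operators are
  explicit formulas (\<open>hochschild_connes_anticommute\<close>, \<open>connes_codiff\<close>).

  To pass between cochains and their values, two universal properties are needed: a graded
  multilinear family of values comes from exactly one cochain (\<open>cochain_of\<close>, \<open>C_eqI\<close>), and the
  differential of a tensor power exists and is unique (\<open>tensor_diff_coset\<close>).
\<close>

section \<open>Cosets\<close>

definition add_subgroup :: "'v::ab_group_add set \<Rightarrow> bool" where
  "add_subgroup D \<longleftrightarrow> 0 \<in> D \<and> (\<forall>x\<in>D. \<forall>y\<in>D. x - y \<in> D)"

lemma add_subgroupD:
  assumes "add_subgroup D"
  shows "0 \<in> D" and "x \<in> D \<Longrightarrow> y \<in> D \<Longrightarrow> x - y \<in> D"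
    and "x \<in> D \<Longrightarrow> - x \<in> D" and "x \<in> D \<Longrightarrow> y \<in> D \<Longrightarrow> x + y \<in> D"
proof -
  show z: "0 \<in> D" using assms by (simp add: add_subgroup_def)
  have d: "u - v \<in> D" if "u \<in> D" "v \<in> D" for u v
    using assms that by (simp add: add_subgroup_def)
  have m: "- u \<in> D" if "u \<in> D" for u using d[OF z that] by simp
  show "x \<in> D \<Longrightarrow> y \<in> D \<Longrightarrow> x - y \<in> D" by (rule d)
  show "x \<in> D \<Longrightarrow> - x \<in> D" by (rule m)
  show "x \<in> D \<Longrightarrow> y \<in> D \<Longrightarrow> x + y \<in> D" using d[of x "- y"] m[of y] by simp
qed

lemma coset_eq_iff:
  assumes "add_subgroup D"
  shows "x +o D = y +o D \<longleftrightarrow> x - y \<in> D"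
proof
  assume "x +o D = y +o D"
  moreover have "x \<in> x +o D" using add_subgroupD(1)[OF assms] by (auto simp: elt_set_plus_def)
  ultimately obtain z where "z \<in> D" "x = y + z" by (auto simp: elt_set_plus_def)
  then show "x - y \<in> D" by simp
next
  assume *: "x - y \<in> D"
  show "x +o D = y +o D"
  proof (intro set_eqI iffI)
    fix z assume "z \<in> x +o D"
    then obtain w where w: "w \<in> D" "z = x + w" by (auto simp: elt_set_plus_def)
    then have "z = y + ((x - y) + w)" by simp
    then show "z \<in> y +o D"
      using add_subgroupD(4)[OF assms * w(1)] unfolding elt_set_plus_def by blast
  next
    fix z assume "z \<in> y +o D"
    then obtain w where w: "w \<in> D" "z = y + w" by (auto simp: elt_set_plus_def)
    then have "z = x + (w - (x - y))" by simp
    then show "z \<in> x +o D"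
      using add_subgroupD(2)[OF assms w(1) *] unfolding elt_set_plus_def by blast
  qed
qed

lemma mem_coset_self: "add_subgroup D \<Longrightarrow> x \<in> x +o D"
  using add_subgroupD(1)[of D] set_plus_intro2[of 0 D x] by simp

lemma coset_zero: "0 +o D = (D::'v::ab_group_add set)"
  by (auto simp: elt_set_plus_def)

text \<open>
  All maps between quotients are given by an image of cosets, thickened by the target subgroup.
  When the map respects the subgroups, this is the usual induced map on classes.
\<close>

lemma image_coset_plus:
  fixes D :: "'v::ab_group_add set" and D' :: "'w::ab_group_add set"
  assumes D': "add_subgroup D'"
    and add: "\<And>y. y \<in> D \<Longrightarrow> h (x + y) = h x + h y"
    and sub: "\<And>y. y \<in> D \<Longrightarrow> h y \<in> D'" and ne: "0 \<in> D"
  shows "h ` (x +o D) + D' = h x +o D'"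
proof (intro set_eqI iffI)
  fix z assume "z \<in> h ` (x +o D) + D'"
  then obtain y w where "y \<in> D" "w \<in> D'" "z = h (x + y) + w"
    by (auto simp: elt_set_plus_def set_plus_def)
  then have "z = h x + (h y + w)" "h y + w \<in> D'"
    using add sub add_subgroupD(4)[OF D'] by (auto simp: add.assoc)
  then show "z \<in> h x +o D'" by (auto simp: elt_set_plus_def)
next
  fix z assume "z \<in> h x +o D'"
  then obtain w where "w \<in> D'" "z = h x + w" by (auto simp: elt_set_plus_def)
  moreover have "x \<in> x +o D" using set_plus_intro2[OF ne, of x] by simp
  ultimately show "z \<in> h ` (x +o D) + D'" by (auto simp: set_plus_def)
qed

lemma coset_plus:
  assumes "add_subgroup D"
  shows "(x +o D) + (y +o D) = (x + y) +o D"
proof (intro set_eqI iffI)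
  fix z assume "z \<in> (x +o D) + (y +o D)"
  then obtain u v where "u \<in> D" "v \<in> D" "z = (x + u) + (y + v)"
    by (auto simp: elt_set_plus_def set_plus_def)
  then have "z = (x + y) + (u + v)" "u + v \<in> D"
    using add_subgroupD(4)[OF assms] by (auto simp: algebra_simps)
  then show "z \<in> (x + y) +o D" by (auto simp: elt_set_plus_def)
next
  fix z assume "z \<in> (x + y) +o D"
  then obtain u where "u \<in> D" "z = x + (y + u)" by (auto simp: elt_set_plus_def add.assoc)
  then show "z \<in> (x +o D) + (y +o D)"
    using mem_coset_self[OF assms] by (auto simp: elt_set_plus_def set_plus_def)
qed

lemma quot_scale_coset:
  assumes "add_subgroup D" and "\<And>y. s c (x + y) = s c x + s c y" and "\<And>y. y \<in> D \<Longrightarrow> s c y \<in> D"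
  shows "quot_scale s D c (x +o D) = s c x +o D"
  unfolding quot_scale_def
  by (rule image_coset_plus) (use assms add_subgroupD(1) in auto)


section \<open>Lifting through the pages of a spectral sequence\<close>

text \<open>
  A vanishing differential \<open>d\<^sub>r\<close> says that \<open>d x = z + d w\<close> with \<open>z\<close> one filtration
  step deeper than expected and \<open>w\<close> deeper than \<open>x\<close>. Hence \<open>x - w\<close> represents the same
  leading term and survives to the next page.
\<close>

lemma ss_lift:
  fixes F :: "int \<Rightarrow> int \<Rightarrow> 'v::ab_group_add set"
  assumes grp: "\<And>s n. add_subgroup (F s n)"
    and dec: "\<And>s n. F (s + 1) n \<subseteq> F s n"
    and diff: "\<And>n x y. x \<in> F s n \<Longrightarrow> y \<in> F s n \<Longrightarrow> d (x - y) = d x - d y"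
    and d0: "d 0 = 0"
    and deg: "ss_degenerates_at F d r0"
    and x: "x \<in> ss_Z F d r0 s n"
  shows "\<exists>y \<in> ss_Z F d (r0 + int k) s n. x - y \<in> F (s + 1) n"
proof (induction k)
  case 0
  show ?case using x add_subgroupD(1)[OF grp] by (auto intro!: bexI[of _ x])
next
  case (Suc k)
  then obtain y where y: "y \<in> ss_Z F d (r0 + int k) s n" "x - y \<in> F (s + 1) n" by blast
  define r where "r = r0 + int k"
  have Z0: "0 \<in> ss_Z F d r' s' n'" for r' s' n'
    using add_subgroupD(1)[OF grp] by (simp add: ss_Z_def d0)
  have B0: "0 \<in> ss_B F d r' s' n'" for r' s' n'
  proof -
    have "0 + d 0 \<in> ss_B F d r' s' n'"
      unfolding ss_B_def by (intro set_plus_intro imageI Z0)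
    then show ?thesis by (simp add: d0)
  qed
  define X where "X = y +o ss_B F d r s n"
  have "X \<in> ss_E F d r s (n - s)"
    using y(1) by (auto simp: X_def ss_E_def quot_def r_def)
  then have eq: "ss_diff F d r s (n - s) X = ss_B F d r (s + r) (n + 1)"
    using deg unfolding ss_degenerates_at_def r_def by force
  have "y + 0 \<in> X" unfolding X_def by (intro set_plus_intro2 B0)
  then have "d y + 0 \<in> ss_diff F d r s (n - s) X"
    unfolding ss_diff_def by (intro set_plus_intro imageI B0) auto
  then have "d y \<in> ss_B F d r (s + r) (n + 1)" using eq by simp
  then obtain z w where z: "z \<in> ss_Z F d (r - 1) (s + r + 1) (n + 1)"
    and w: "w \<in> ss_Z F d (r - 1) (s + 1) n" and dy: "d y = z + d w"
    unfolding ss_B_def by (auto elim!: set_plus_elim)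
  have wF: "w \<in> F (s + 1) n" and zF: "z \<in> F (s + (r + 1)) (n + 1)"
    using w z by (auto simp: ss_Z_def add.assoc)
  have yF: "y \<in> F s n" using y(1) by (auto simp: ss_Z_def)
  have wF': "w \<in> F s n" using wF dec by auto
  have "d (y - w) = z" using diff[OF yF wF'] dy by simp
  moreover have "y - w \<in> F s n" by (rule add_subgroupD(2)[OF grp yF wF'])
  ultimately have "y - w \<in> ss_Z F d (r + 1) s n" using zF by (simp add: ss_Z_def)
  moreover have "x - (y - w) \<in> F (s + 1) n"
    using add_subgroupD(4)[OF grp y(2) wF] by (simp add: algebra_simps)
  ultimately show ?case by (auto simp: r_def ac_simps)
qed


section \<open>Linear extension from lists to the free vector space\<close>

definition free_ext :: "('k::field \<Rightarrow> 'w::ab_group_add \<Rightarrow> 'w) \<Rightarrow> ('b list \<Rightarrow> 'w) \<Rightarrow> ('b list \<Rightarrow>\<^sub>0 'k) \<Rightarrow> 'w" where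
  "free_ext s V x = (\<Sum>as\<in>Poly_Mapping.keys x. s (Poly_Mapping.lookup x as) (V as))"

context
  fixes s :: "'k::field \<Rightarrow> 'w::ab_group_add \<Rightarrow> 'w"
  assumes vs: "vector_space s"
begin

interpretation W: vector_space s by (rule vs)

lemma free_ext_superset:
  assumes "finite S" "Poly_Mapping.keys x \<subseteq> S"
  shows "free_ext s V x = (\<Sum>as\<in>S. s (Poly_Mapping.lookup x as) (V as))"
  unfolding free_ext_def using assms
  by (intro sum.mono_neutral_left) (auto simp: in_keys_iff)

lemma free_ext_add: "free_ext s V (x + y) = free_ext s V x + free_ext s V y"
proof -
  let ?S = "Poly_Mapping.keys x \<union> Poly_Mapping.keys y"
  have "Poly_Mapping.keys (x + y) \<subseteq> ?S" by (rule Poly_Mapping.keys_add)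
  then have "free_ext s V (x + y) = (\<Sum>as\<in>?S. s (Poly_Mapping.lookup (x + y) as) (V as))"
    by (intro free_ext_superset) auto
  also have "\<dots> = free_ext s V x + free_ext s V y"
    by (simp add: free_ext_superset[where S = ?S] lookup_add W.scale_left_distrib sum.distrib)
  finally show ?thesis .
qed

lemma free_ext_scale: "free_ext s V (free_scale c x) = s c (free_ext s V x)"
proof -
  have "Poly_Mapping.keys (free_scale c x) \<subseteq> Poly_Mapping.keys x"
    by (auto simp: in_keys_iff lookup_free_scale)
  then have "free_ext s V (free_scale c x)
      = (\<Sum>as\<in>Poly_Mapping.keys x. s (Poly_Mapping.lookup (free_scale c x) as) (V as))"
    by (intro free_ext_superset) auto
  then show ?thesis
    by (simp add: lookup_free_scale free_ext_def W.scale_sum_right)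
qed

lemma free_ext_single: "free_ext s V (Poly_Mapping.single as c) = s c (V as)"
  by (subst free_ext_superset[where S = "{as}"]) auto

lemma free_ext_diff: "free_ext s V (x - y) = free_ext s V x - free_ext s V y"
  using free_ext_add[of V "x - y" y] by (simp add: algebra_simps)

lemma free_ext_zero: "free_ext s V 0 = 0"
  by (simp add: free_ext_def)

lemma free_ext_subspace_vimage:
  assumes "module.subspace s R" shows "free.subspace {x. free_ext s V x \<in> R}"
  using assms
  by (auto simp: free.subspace_def W.subspace_def free_ext_add free_ext_scale free_ext_zero)

end

lemma free_scale_single: "free_scale c (Poly_Mapping.single as d) = Poly_Mapping.single as (c * d)"
  by (rule poly_mapping_eqI) (auto simp: lookup_free_scale lookup_single when_def)

lemma free_vs: "vector_space (free_scale :: 'k::field \<Rightarrow> ('b list \<Rightarrow>\<^sub>0 'k) \<Rightarrow> _)"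
  by (rule free.vector_space_axioms)

lemma field_vs: "vector_space ((*) :: 'k::field \<Rightarrow> 'k \<Rightarrow> 'k)"
  by unfold_locales (auto simp: algebra_simps)

lemma free_subgroup: "free.subspace D \<Longrightarrow> add_subgroup D"
  unfolding add_subgroup_def using free.subspace_0 free.subspace_diff by blast


context dga
begin

section \<open>Homogeneous components\<close>

definition component :: "'a \<Rightarrow> nat \<Rightarrow> 'a" where
  "component x = (THE f. (\<forall>m. f m \<in> A m) \<and> finite {m. f m \<noteq> 0} \<and> x = (\<Sum>m | f m \<noteq> 0. f m))"

lemma component:
  shows component_in: "component x m \<in> A m"
    and finite_component: "finite {m. component x m \<noteq> 0}"
    and sum_component: "(\<Sum>m | component x m \<noteq> 0. component x m) = x"
  using theI'[OF direct_sum_A[of x]] by (simp_all flip: component_def)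

lemma component_unique:
  assumes "\<And>m. f m \<in> A m" "finite S" "\<And>m. m \<notin> S \<Longrightarrow> f m = 0" "x = (\<Sum>m\<in>S. f m)"
  shows "component x = f"
proof -
  have "{m. f m \<noteq> 0} \<subseteq> S" using assms(3) by blast
  then have "finite {m. f m \<noteq> 0}" "x = (\<Sum>m | f m \<noteq> 0. f m)"
    using assms(2,4) finite_subset by (auto intro: sum.mono_neutral_right)
  then show ?thesis
    unfolding component_def using assms(1) by (intro the1_equality direct_sum_A) auto
qed

lemma sum_component_superset:
  assumes "finite S" "{m. component x m \<noteq> 0} \<subseteq> S"
  shows "(\<Sum>m\<in>S. component x m) = x"
  using sum.mono_neutral_left[OF assms, of "component x"] sum_component[of x] by auto

lemma component_add: "component (x + y) m = component x m + component y m"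
proof -
  let ?S = "{m. component x m \<noteq> 0} \<union> {m. component y m \<noteq> 0}"
  have "component (x + y) = (\<lambda>m. component x m + component y m)"
  proof (rule component_unique)
    show "finite ?S" by (simp add: finite_component)
    show "x + y = (\<Sum>m\<in>?S. component x m + component y m)"
      by (simp add: sum.distrib sum_component_superset finite_component)
  qed (auto intro: subspace_add subspace_A component_in)
  then show ?thesis by simp
qed

lemma component_scale: "component (scale c x) m = scale c (component x m)"
proof -
  have "component (scale c x) = (\<lambda>m. scale c (component x m))"
  proof (rule component_unique)
    show "finite {m. component x m \<noteq> 0}" by (rule finite_component)
    show "scale c x = (\<Sum>m | component x m \<noteq> 0. scale c (component x m))"
      by (simp add: sum_component flip: scale_sum_right)
  qed (auto intro: subspace_scale subspace_A component_in)
  then show ?thesis by simp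
qed

lemma A_0: "0 \<in> A m"
  by (rule subspace_0[OF subspace_A])

lemma component_homogeneous: "x \<in> A d \<Longrightarrow> component x = (\<lambda>m. if m = d then x else 0)"
  by (rule component_unique[where S = "{d}"]) (auto simp: A_0)

text \<open>
  The degree \<open>0\<close> component \<open>e\<close> of the unit acts as a left unit on every homogeneous
  element, by comparing degrees in \<open>x = 1 * x\<close>, hence on \<open>1\<close>, so that \<open>e = 1\<close>.
\<close>

lemma one_in_A_0: "1 \<in> A 0"
proof -
  define S where "S = {m. component 1 m \<noteq> (0::'a)}"
  have fin: "finite S" by (simp add: S_def finite_component)
  have hom: "component 1 0 * x = x" if x: "x \<in> A d" for x d
  proof -
    define f where "f k = (if d \<le> k then component 1 (k - d) * x else 0)" for k
    have "component x = f"
    proof (rule component_unique)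
      show "f k \<in> A k" for k
        using mult_A[OF component_in x, of 1 "k - d"] by (auto simp: f_def A_0)
      show "finite ((\<lambda>m. m + d) ` S)" using fin by simp
      show "f k = 0" if "k \<notin> (\<lambda>m. m + d) ` S" for k
      proof (cases "d \<le> k")
        case True
        then have "k = (k - d) + d" by simp
        with that have "k - d \<notin> S" by blast
        then show ?thesis by (simp add: f_def S_def)
      qed (simp add: f_def)
      have "x = (\<Sum>m\<in>S. component 1 m) * x"
        using sum_component[of 1] by (simp add: S_def)
      also have "\<dots> = (\<Sum>m\<in>S. f (m + d))" by (simp add: sum_distrib_right f_def)
      also have "\<dots> = (\<Sum>k\<in>(\<lambda>m. m + d) ` S. f k)" by (simp add: sum.reindex inj_on_def)
      finally show "x = (\<Sum>k\<in>(\<lambda>m. m + d) ` S. f k)" .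
    qed
    then have "component x d = f d" by simp
    then show ?thesis by (simp add: component_homogeneous[OF x] f_def)
  qed
  have "component 1 0 = component 1 0 * (\<Sum>m\<in>S. component 1 m)"
    using sum_component[of 1] by (simp add: S_def)
  also have "\<dots> = (\<Sum>m\<in>S. component 1 m)" by (simp add: sum_distrib_left hom[OF component_in])
  also have "\<dots> = 1" using sum_component[of 1] by (simp add: S_def)
  finally show ?thesis using component_in[of 1 0] by simp
qed

lemma \<phi>_add: "\<phi> (x + y) = \<phi> x + \<phi> y" and \<phi>_scale: "\<phi> (scale c x) = scale c (\<phi> x)"
  using linear_\<phi> by (auto simp: Vector_Spaces.linear_iff)

definition grading_involution :: "'a \<Rightarrow> 'a" where
  "grading_involution x = (\<Sum>m | component x m \<noteq> 0. scale ((-1) ^ m) (component x m))"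

lemma grading_involution_superset:
  assumes "finite S" "{m. component x m \<noteq> 0} \<subseteq> S"
  shows "grading_involution x = (\<Sum>m\<in>S. scale ((-1) ^ m) (component x m))"
  unfolding grading_involution_def using assms by (intro sum.mono_neutral_left) auto

lemma grading_involution_add:
  "grading_involution (x + y) = grading_involution x + grading_involution y"
proof -
  let ?S = "{m. component x m \<noteq> 0} \<union> {m. component y m \<noteq> 0}"
  have "finite ?S" "{m. component (x + y) m \<noteq> 0} \<subseteq> ?S"
    by (auto simp: finite_component component_add)
  then show ?thesis
    by (simp add: grading_involution_superset[where S = ?S] component_add scale_right_distrib
        sum.distrib)
qed

lemma grading_involution_scale: "grading_involution (scale c x) = scale c (grading_involution x)"
proof -
  have "{m. component (scale c x) m \<noteq> 0} \<subseteq> {m. component x m \<noteq> 0}"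
    by (auto simp: component_scale)
  then show ?thesis
    using grading_involution_superset[OF finite_component, of "scale c x" x]
    by (simp add: grading_involution_def component_scale scale_sum_right mult.commute)
qed

lemma grading_involution_homogeneous: "x \<in> A d \<Longrightarrow> grading_involution x = scale ((-1) ^ d) x"
  by (subst grading_involution_superset[where S = "{d}"]) (auto simp: component_homogeneous)


section \<open>Linear maps on tensor powers\<close>

text \<open>
  Working modulo \<open>R\<close> covers both functionals (\<open>R = 0\<close>) and maps into another tensor power,
  where \<open>R\<close> consists of the multilinearity relations of the target.
\<close>

definition multilinear_mod ::
  "nat \<Rightarrow> ('k \<Rightarrow> 'w::ab_group_add \<Rightarrow> 'w) \<Rightarrow> 'w set \<Rightarrow> ('a list \<Rightarrow> 'w) \<Rightarrow> bool" where
  "multilinear_mod n s R V \<longleftrightarrow> (\<forall>as j x y c. length as = n \<and> j < n \<longrightarrow>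
     V (as[j := x + y]) - V (as[j := x]) - V (as[j := y]) \<in> R \<and>
     V (as[j := scale c x]) - s c (V (as[j := x])) \<in> R)"

lemma multilinear_mod_single:
  "multilinear_mod n free_scale (tensor_rel n) (\<lambda>as. Poly_Mapping.single as 1)"
  unfolding multilinear_mod_def
proof (intro allI impI)
  fix as :: "'a list" and j :: nat and x y c
  assume as: "length as = n \<and> j < n"
  then have upd: "as[j := z] = take j as @ z # drop (Suc j) as" for z
    by (simp add: upd_conv_take_nth_drop)
  have len: "length (take j as) + length (drop (Suc j) as) + 1 = n" using as by simp
  show "Poly_Mapping.single (as[j := x + y]) 1 - Poly_Mapping.single (as[j := x]) 1
        - Poly_Mapping.single (as[j := y]) 1 \<in> tensor_rel n \<and>
      Poly_Mapping.single (as[j := scale c x]) 1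
        - free_scale c (Poly_Mapping.single (as[j := x]) 1) \<in> tensor_rel n"
    unfolding tensor_rel_def free_scale_single mult_1_right upd
    by (intro conjI free.span_base) (use len in blast)+
qed

lemma free_ext_tensor_rel:
  fixes s :: "'k \<Rightarrow> 'w::ab_group_add \<Rightarrow> 'w"
  assumes vs: "vector_space s" and R: "module.subspace s R" and V: "multilinear_mod n s R V"
    and x: "x \<in> tensor_rel n"
  shows "free_ext s V x \<in> R"
proof -
  interpret W: vector_space s by (rule vs)
  have upd: "(xs @ u # ys)[length xs := z] = xs @ z # ys" for xs ys :: "'a list" and u z by simp
  have "tensor_rel n \<subseteq> {x. free_ext s V x \<in> R}"
    unfolding tensor_rel_def
  proof (rule free.span_minimal[OF _ free_ext_subspace_vimage[OF vs R]], safe)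
    fix xs ys :: "'a list" and u v assume n: "n = length xs + length ys + 1"
    have "V ((xs @ u # ys)[length xs := u + v]) - V ((xs @ u # ys)[length xs := u])
        - V ((xs @ u # ys)[length xs := v]) \<in> R"
      using V[unfolded multilinear_mod_def, rule_format, of "xs @ u # ys" "length xs" u v] n by simp
    then show "free_ext s V (Poly_Mapping.single (xs @ (u + v) # ys) 1
         - Poly_Mapping.single (xs @ u # ys) 1 - Poly_Mapping.single (xs @ v # ys) 1) \<in> R"
      by (simp add: free_ext_diff[OF vs] free_ext_single[OF vs])
  next
    fix xs ys :: "'a list" and c u assume n: "n = length xs + length ys + 1"
    have "V ((xs @ u # ys)[length xs := scale c u]) - s c (V ((xs @ u # ys)[length xs := u])) \<in> R"
      using V[unfolded multilinear_mod_def, rule_format, of "xs @ u # ys" "length xs" u _ c] n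
      by simp
    then show "free_ext s V (Poly_Mapping.single (xs @ scale c u # ys) 1
         - Poly_Mapping.single (xs @ u # ys) c) \<in> R"
      by (simp add: free_ext_diff[OF vs] free_ext_single[OF vs])
  qed
  then show ?thesis using x by blast
qed

lemma subspace_tensor_rel: "free.subspace (tensor_rel n)"
  unfolding tensor_rel_def by (rule free.subspace_span)

lemmas tensor_rel_subgroup = free_subgroup[OF subspace_tensor_rel]

lemma single_zero_in_tensor_rel:
  assumes "length as = n" "j < n" "as ! j = 0"
  shows "Poly_Mapping.single as c \<in> tensor_rel n"
proof -
  have as: "as[j := 0] = as" using assms by (metis list_update_id)
  have "Poly_Mapping.single as 1 \<in> tensor_rel n"
    using multilinear_mod_single[of n, unfolded multilinear_mod_def, rule_format, of as j 0 0 0]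
      assms by (simp add: as)
  then show ?thesis
    using free.subspace_scale[OF subspace_tensor_rel, of _ n c] by (force simp: free_scale_single)
qed

text \<open>
  Operations on lists of the kind that occurs in the cyclic operators: changing one entry of the
  input changes one entry of the output, linearly. Multilinear maps are stable under composition
  with them.
\<close>

definition slotwise :: "nat \<Rightarrow> nat \<Rightarrow> ('a list \<Rightarrow> 'a list) \<Rightarrow> bool" where
  "slotwise n n' \<sigma> \<longleftrightarrow> (\<forall>as. length as = n \<longrightarrow> length (\<sigma> as) = n' \<and>
     (\<forall>j<n. \<exists>j'<n'. \<exists>h. (\<forall>x y. h (x + y) = h x + h y) \<and> (\<forall>c x. h (scale c x) = scale c (h x)) \<and>
        (\<forall>x. \<sigma> (as[j := x]) = (\<sigma> as)[j' := h x])))"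

lemma slotwiseI:
  assumes "\<And>as. length as = n \<Longrightarrow> length (\<sigma> as) = n'"
    and "\<And>as j. length as = n \<Longrightarrow> j < n \<Longrightarrow> \<exists>j'<n'. \<exists>h. (\<forall>x y. h (x + y) = h x + h y) \<and>
      (\<forall>c x. h (scale c x) = scale c (h x)) \<and> (\<forall>x. \<sigma> (as[j := x]) = (\<sigma> as)[j' := h x])"
  shows "slotwise n n' \<sigma>"
  using assms by (simp add: slotwise_def)

lemma slotwiseE:
  assumes "slotwise n n' \<sigma>" "length as = n" "j < n"
  obtains j' h where "j' < n'" "\<forall>x y. h (x + y) = h x + h y"
    "\<forall>c x. h (scale c x) = scale c (h x)" "\<forall>x. \<sigma> (as[j := x]) = (\<sigma> as)[j' := h x]"
proof -
  have "\<exists>j'<n'. \<exists>h. (\<forall>x y. h (x + y) = h x + h y) \<and> (\<forall>c x. h (scale c x) = scale c (h x)) \<and>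
      (\<forall>x. \<sigma> (as[j := x]) = (\<sigma> as)[j' := h x])"
    using assms by (simp add: slotwise_def)
  then show ?thesis using that by blast
qed

lemma slotwise_compose:
  assumes s1: "slotwise n n' \<sigma>" and s2: "slotwise n' n'' \<rho>"
  shows "slotwise n n'' (\<lambda>as. \<rho> (\<sigma> as))"
proof (rule slotwiseI)
  fix as :: "'a list" assume as: "length as = n"
  then have s: "length (\<sigma> as) = n'" using s1 by (simp add: slotwise_def)
  then show "length (\<rho> (\<sigma> as)) = n''" using s2 by (simp add: slotwise_def)
  fix j assume "j < n"
  then obtain j' h where 1: "j' < n'" "\<forall>x y. h (x + y) = h x + h y"
    "\<forall>c x. h (scale c x) = scale c (h x)" "\<forall>x. \<sigma> (as[j := x]) = (\<sigma> as)[j' := h x]"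
    by (rule slotwiseE[OF s1 as])
  obtain j'' g where 2: "j'' < n''" "\<forall>x y. g (x + y) = g x + g y"
    "\<forall>c x. g (scale c x) = scale c (g x)" "\<forall>x. \<rho> ((\<sigma> as)[j' := x]) = (\<rho> (\<sigma> as))[j'' := g x]"
    by (rule slotwiseE[OF s2 s 1(1)])
  show "\<exists>j'<n''. \<exists>h. (\<forall>x y. h (x + y) = h x + h y) \<and>
      (\<forall>c x. h (scale c x) = scale c (h x)) \<and> (\<forall>x. \<rho> (\<sigma> (as[j := x])) = (\<rho> (\<sigma> as))[j' := h x])"
    using 1 2 by (intro exI[of _ j''] conjI exI[of _ "\<lambda>x. g (h x)"]) auto
qed

lemma slotwise_multilinear_mod:
  assumes s: "slotwise n n' \<sigma>" and V: "multilinear_mod n' s R V"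
  shows "multilinear_mod n s R (\<lambda>as. V (\<sigma> as))"
  unfolding multilinear_mod_def
proof (intro allI impI)
  fix as :: "'a list" and j x y c assume as: "length as = n \<and> j < n"
  then obtain j' h where 1: "j' < n'" "\<forall>x y. h (x + y) = h x + h y"
    "\<forall>c x. h (scale c x) = scale c (h x)" "\<forall>x. \<sigma> (as[j := x]) = (\<sigma> as)[j' := h x]"
    using slotwiseE[OF s] by blast
  moreover have "length (\<sigma> as) = n'" using s as by (simp add: slotwise_def)
  ultimately show "V (\<sigma> (as[j := x + y])) - V (\<sigma> (as[j := x])) - V (\<sigma> (as[j := y])) \<in> R \<and>
     V (\<sigma> (as[j := scale c x])) - s c (V (\<sigma> (as[j := x]))) \<in> R"
    using V by (auto simp: multilinear_mod_def)
qed

lemma multilinear_mod_sum: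
  assumes vs: "vector_space s" and R: "module.subspace s R" and fin: "finite I"
    and V: "\<And>i. i \<in> I \<Longrightarrow> multilinear_mod n s R (V i)"
  shows "multilinear_mod n s R (\<lambda>as. \<Sum>i\<in>I. V i as)"
proof -
  interpret W: vector_space s by (rule vs)
  show ?thesis
    unfolding multilinear_mod_def W.scale_sum_right sum_subtractf[symmetric]
    using V by (auto simp: multilinear_mod_def intro!: W.subspace_sum[OF R])
qed

lemma slotwise_map_at:
  assumes i: "i < n"
    and f: "\<And>x y. f (x + y) = f x + f y" "\<And>c x. f (scale c x) = scale c (f x)"
    and g: "\<And>x y. g (x + y) = g x + g y" "\<And>c x. g (scale c x) = scale c (g x)"
  shows "slotwise n n (\<lambda>as. map g (take i as) @ f (as ! i) # drop (Suc i) as)"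
proof (rule slotwiseI)
  fix as :: "'a list" and j assume as: "length as = n" and j: "j < n"
  define h where "h = (if j < i then g else if j = i then f else id)"
  have "map g (take i (as[j := x])) @ f (as[j := x] ! i) # drop (Suc i) (as[j := x])
      = (map g (take i as) @ f (as ! i) # drop (Suc i) as)[j := h x]" for x
    using as i j
    by (intro nth_equalityI) (auto simp: h_def nth_append nth_list_update nth_Cons' min_def)
  then show "\<exists>j'<n. \<exists>h. (\<forall>x y. h (x + y) = h x + h y) \<and> (\<forall>c x. h (scale c x) = scale c (h x)) \<and>
      (\<forall>x. map g (take i (as[j := x])) @ f (as[j := x] ! i) # drop (Suc i) (as[j := x])
      = (map g (take i as) @ f (as ! i) # drop (Suc i) as)[j' := h x])"
    using j f g by (intro exI[of _ j] conjI exI[of _ h]) (auto simp: h_def)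
qed (use i in auto)


section \<open>Cochains as functions of homogeneous lists\<close>

text \<open>
  Linear maps on tensor powers are computed on representatives. These form a subspace that is
  larger than the span used to define the quotient: it contains all multilinearity relations.
\<close>

definition representatives :: "nat \<Rightarrow> ('k, 'a) tensor set \<Rightarrow> ('a list \<Rightarrow>\<^sub>0 'k) set" where
  "representatives n Q = {x. x +o tensor_rel n \<in> Q}"

lemma representatives_quot:
  "representatives n (quot W (tensor_rel n)) = {h + r | h r. h \<in> W \<and> r \<in> tensor_rel n}"
proof (intro set_eqI iffI)
  fix x assume "x \<in> representatives n (quot W (tensor_rel n))"
  then obtain h where "h \<in> W" "x - h \<in> tensor_rel n"
    by (auto simp: representatives_def quot_def coset_eq_iff[OF tensor_rel_subgroup])
  then show "x \<in> {h + r | h r. h \<in> W \<and> r \<in> tensor_rel n}"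
    by (intro CollectI exI[of _ h] exI[of _ "x - h"]) simp
next
  fix x assume "x \<in> {h + r | h r. h \<in> W \<and> r \<in> tensor_rel n}"
  then obtain h where "h \<in> W" "x - h \<in> tensor_rel n" by auto
  then show "x \<in> representatives n (quot W (tensor_rel n))"
    using coset_eq_iff[OF tensor_rel_subgroup, of x n h]
    by (auto simp: representatives_def quot_def)
qed

lemma representatives_span:
  shows subspace_representatives_span:
      "free.subspace (representatives n (quot (free.span S) (tensor_rel n)))"
    and span_subset_representatives: "S \<subseteq> representatives n (quot (free.span S) (tensor_rel n))"
    and tensor_rel_subset_representatives:
      "tensor_rel n \<subseteq> representatives n (quot (free.span S) (tensor_rel n))"
proof -
  show "free.subspace (representatives n (quot (free.span S) (tensor_rel n)))"
    unfolding representatives_quot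
    by (rule free.subspace_sums[OF free.subspace_span subspace_tensor_rel])
  show "S \<subseteq> representatives n (quot (free.span S) (tensor_rel n))"
    unfolding representatives_quot
    using free.subspace_0[OF subspace_tensor_rel, of n] free.span_base[of _ S] by force
  show "tensor_rel n \<subseteq> representatives n (quot (free.span S) (tensor_rel n))"
    unfolding representatives_quot using free.span_zero[of S] by force
qed

lemma representatives_span_minimal:
  assumes "free.subspace E" "S \<subseteq> E" "tensor_rel n \<subseteq> E"
  shows "representatives n (quot (free.span S) (tensor_rel n)) \<subseteq> E"
  unfolding representatives_quot
  using free.span_minimal[OF assms(2,1)] assms(3) free.subspace_add[OF assms(1)] by blast

lemma quot_obtain_representative:
  assumes "X \<in> quot W (tensor_rel n)"
  obtains x where "X = x +o tensor_rel n" "x \<in> representatives n (quot W (tensor_rel n))"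
  using assms by (auto simp: quot_def representatives_def)

abbreviation "pow_reps n \<equiv> representatives n (tensor_pow n)"
abbreviation "deg_reps n m \<equiv> representatives n (tensor_pow_deg n m)"

lemmas subspace_pow_reps = subspace_representatives_span[
    where n = n and S = "{Poly_Mapping.single as 1 | as. length as = n}" for n, folded tensor_pow_def]
lemmas subspace_deg_reps = subspace_representatives_span[
    where n = n and S = "{Poly_Mapping.single as 1 | as ds. length as = n \<and> homog ds as \<and> sum_list ds = m}"
    for n m, folded tensor_pow_deg_def]
lemmas tensor_rel_pow_reps = tensor_rel_subset_representatives[
    where n = n and S = "{Poly_Mapping.single as 1 | as. length as = n}" for n, folded tensor_pow_def]
lemmas tensor_rel_deg_reps = tensor_rel_subset_representatives[
    where n = n and S = "{Poly_Mapping.single as 1 | as ds. length as = n \<and> homog ds as \<and> sum_list ds = m}"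
    for n m, folded tensor_pow_deg_def]

lemma single_in_pow_reps: "length as = n \<Longrightarrow> Poly_Mapping.single as c \<in> pow_reps n"
  using free.subspace_scale[OF subspace_pow_reps, of "Poly_Mapping.single as 1" n c]
    span_subset_representatives[of "{Poly_Mapping.single as 1 | as. length as = n}" n]
  by (auto simp: free_scale_single tensor_pow_def)

lemma single_in_deg_reps:
  "length as = n \<Longrightarrow> homog ds as \<Longrightarrow> sum_list ds = m \<Longrightarrow> Poly_Mapping.single as c \<in> deg_reps n m"
  using free.subspace_scale[OF subspace_deg_reps, of "Poly_Mapping.single as 1" n m c]
    span_subset_representatives[of
      "{Poly_Mapping.single as 1 | as ds. length as = n \<and> homog ds as \<and> sum_list ds = m}" n]
  by (auto simp: free_scale_single tensor_pow_deg_def)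

lemma deg_reps_subset_pow_reps: "deg_reps n m \<subseteq> pow_reps n"
  unfolding tensor_pow_deg_def
  by (rule representatives_span_minimal[OF subspace_pow_reps _ tensor_rel_pow_reps])
    (auto intro: single_in_pow_reps)

lemma elem_tensor_eq: "length as = n \<Longrightarrow> elem_tensor as = Poly_Mapping.single as 1 +o tensor_rel n"
  by (simp add: elem_tensor_def)

lemma quot_scale_tensor_coset:
  "quot_scale free_scale (tensor_rel n) c (x +o tensor_rel n) = free_scale c x +o tensor_rel n"
  by (rule quot_scale_coset[OF tensor_rel_subgroup])
    (auto simp: free.scale_right_distrib free.subspace_scale[OF subspace_tensor_rel])

lemma
  assumes f: "f \<in> C n m"
  shows C_add: "x \<in> deg_reps (Suc n) m \<Longrightarrow> y \<in> deg_reps (Suc n) m \<Longrightarrow>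
      f ((x + y) +o tensor_rel (Suc n)) = f (x +o tensor_rel (Suc n)) + f (y +o tensor_rel (Suc n))"
    and C_scale: "x \<in> deg_reps (Suc n) m \<Longrightarrow>
      f (free_scale c x +o tensor_rel (Suc n)) = c * f (x +o tensor_rel (Suc n))"
    and C_outside: "X \<notin> tensor_pow_deg (Suc n) m \<Longrightarrow> f X = 0"
  using f unfolding C_def Suc_eq_plus1[symmetric]
  by (auto simp: representatives_def simp flip: coset_plus[OF tensor_rel_subgroup]
      quot_scale_tensor_coset)

lemma C_tensor_rel:
  assumes "f \<in> C n m" "x \<in> tensor_rel (Suc n)"
  shows "f (x +o tensor_rel (Suc n)) = 0"
proof -
  have "x +o tensor_rel (Suc n) = free_scale 0 0 +o tensor_rel (Suc n)"
    using assms(2) coset_eq_iff[OF tensor_rel_subgroup, of x "Suc n" 0] by simp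
  then show ?thesis
    using C_scale[OF assms(1), of 0 0] free.subspace_0[OF subspace_deg_reps] by simp
qed

lemma C_sum:
  assumes f: "f \<in> C n m" and "\<And>i. i \<in> I \<Longrightarrow> x i \<in> deg_reps (Suc n) m" and "finite I"
  shows "f ((\<Sum>i\<in>I. x i) +o tensor_rel (Suc n)) = (\<Sum>i\<in>I. f (x i +o tensor_rel (Suc n)))"
  using assms(3,2)
proof (induction rule: finite_induct)
  case empty
  then show ?case
    using C_tensor_rel[OF f free.subspace_0[OF subspace_tensor_rel]] by simp
next
  case (insert i I)
  then show ?case
    using free.subspace_sum[OF subspace_deg_reps, of I x]
    by (simp add: C_add[OF f])
qed

lemma C_single:
  assumes f: "f \<in> C n m" and "length as = Suc n" "homog ds as" "sum_list ds = m"
  shows "f (Poly_Mapping.single as c +o tensor_rel (Suc n)) = c * f (elem_tensor as)"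
  using C_scale[OF f single_in_deg_reps[OF assms(2-4)], of c 1] assms(2)
  by (simp add: elem_tensor_def free_scale_single)

lemma C_eqI:
  assumes f: "f \<in> C n m" and g: "g \<in> C n m"
    and eq: "\<And>ds as. length as = Suc n \<Longrightarrow> homog ds as \<Longrightarrow> sum_list ds = m \<Longrightarrow>
      f (elem_tensor as) = g (elem_tensor as)"
  shows "f = g"
proof
  fix X
  let ?R = "tensor_rel (Suc n)"
  let ?E = "{x \<in> deg_reps (Suc n) m. f (x +o ?R) = g (x +o ?R)}"
  have "free.subspace ?E"
    using subspace_deg_reps C_tensor_rel[OF f free.subspace_0[OF subspace_tensor_rel]]
      C_tensor_rel[OF g free.subspace_0[OF subspace_tensor_rel]]
    by (auto simp: free.subspace_def C_add[OF f] C_add[OF g] C_scale[OF f] C_scale[OF g])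
  moreover have "{Poly_Mapping.single as 1 | as ds. length as = Suc n \<and> homog ds as \<and> sum_list ds = m}
      \<subseteq> ?E"
    using eq single_in_deg_reps by (auto simp: C_single[OF f] C_single[OF g])
  moreover have "?R \<subseteq> ?E"
    using tensor_rel_deg_reps C_tensor_rel[OF f] C_tensor_rel[OF g] by auto
  ultimately have sub: "deg_reps (Suc n) m \<subseteq> ?E"
    using representatives_span_minimal by (simp add: tensor_pow_deg_def)
  show "f X = g X"
  proof (cases "X \<in> tensor_pow_deg (Suc n) m")
    case True
    then show ?thesis
      using sub quot_obtain_representative unfolding tensor_pow_deg_def by blast
  qed (simp add: C_outside[OF f] C_outside[OF g])
qed

lemma C_subspace:
  shows C_zero: "0 \<in> C n m"
    and C_plus: "f \<in> C n m \<Longrightarrow> g \<in> C n m \<Longrightarrow> f + g \<in> C n m"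
    and C_scaled: "f \<in> C n m \<Longrightarrow> (\<lambda>X. c * f X) \<in> C n m"
    and C_minus: "f \<in> C n m \<Longrightarrow> g \<in> C n m \<Longrightarrow> f - g \<in> C n m"
  by (auto simp: C_def algebra_simps)


subsection \<open>Construction of cochains\<close>

text \<open>
  The degrees \<open>ds\<close> are kept fixed while an entry varies, since the signs in the values of the
  cyclic operators depend on them.
\<close>

definition graded_multilinear :: "nat \<Rightarrow> nat \<Rightarrow> (nat list \<Rightarrow> 'a list \<Rightarrow> 'k) \<Rightarrow> bool" where
  "graded_multilinear n m v \<longleftrightarrow> (\<forall>ds as j x y c.
     length as = n \<and> homog ds as \<and> sum_list ds = m \<and> j < n \<and> x \<in> A (ds ! j) \<and> y \<in> A (ds ! j) \<longrightarrow>
     v ds (as[j := x + y]) = v ds (as[j := x]) + v ds (as[j := y]) \<and>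
     v ds (as[j := scale c x]) = c * v ds (as[j := x]))"

lemma graded_multilinear_zero:
  assumes "graded_multilinear n m v" "length as = n" "homog ds as" "sum_list ds = m" "j < n" "as ! j = 0"
  shows "v ds as = 0"
proof -
  have "v ds (as[j := scale 0 0]) = 0 * v ds (as[j := 0])"
    using assms A_0 unfolding graded_multilinear_def by blast
  moreover have "as[j := 0] = as" using assms by (simp add: list_update_same_conv)
  ultimately show ?thesis by simp
qed

lemma homog_length: "homog ds as \<Longrightarrow> length ds = length as"
  by (auto simp: homog_def list_all2_lengthD)

lemma homog_iff_nth: "homog ds as \<longleftrightarrow> length ds = length as \<and> (\<forall>i<length as. as ! i \<in> A (ds ! i))"
  by (auto simp: homog_def list_all2_conv_all_nth)

lemma homog_update: "homog ds as \<Longrightarrow> x \<in> A (ds ! j) \<Longrightarrow> homog ds (as[j := x])"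
  by (cases "j < length as") (auto simp: homog_iff_nth nth_list_update)

text \<open>
  Summing the values at all tuples of homogeneous components of total degree \<open>m\<close> gives a
  functional that is multilinear in arbitrary arguments. On homogeneous arguments only the tuple of
  the given degrees contributes, because in every other tuple some component vanishes.
\<close>

lemma cochain_of:
  assumes v: "graded_multilinear (Suc n) m v"
  shows cochain_of_in_C: "cochain_of n m v \<in> C n m"
    and cochain_of_elem: "length as = Suc n \<Longrightarrow> homog ds as \<Longrightarrow> sum_list ds = m \<Longrightarrow>
      cochain_of n m v (elem_tensor as) = v ds as"
proof -
  let ?R = "tensor_rel (Suc n)"
  \<comment> \<open>The possible degrees of the factors of a homogeneous tensor.\<close>
  define DS where "DS = {ds. length ds = Suc n \<and> sum_list ds = m}"
  have "DS \<subseteq> {ds. set ds \<subseteq> {..m} \<and> length ds = Suc n}"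
    using member_le_sum_list by (auto simp: DS_def)
  then have fin: "finite DS"
    using finite_lists_length_eq[of "{..m}" "Suc n"] finite_subset by blast
  define V where "V as = (\<Sum>ds\<in>DS. v ds (map2 component as ds))" for as
  have upd: "map2 component (as[j := x]) ds = (map2 component as ds)[j := component x (ds ! j)]"
    if "length as = Suc n" "length ds = Suc n" "j < Suc n" for as ds x j
    using that by (intro nth_equalityI) (auto simp: nth_list_update)
  have hom: "homog ds (map2 component as ds)" if "length as = Suc n" "length ds = Suc n" for as ds
    using that by (auto simp: homog_iff_nth component_in)
  have "multilinear_mod (Suc n) (*) {0} V"
    unfolding multilinear_mod_def
  proof (intro allI impI)
    fix as :: "'a list" and j x y c assume as: "length as = Suc n \<and> j < Suc n"
    have t: "v ds (map2 component (as[j := x + y]) ds)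
        = v ds (map2 component (as[j := x]) ds) + v ds (map2 component (as[j := y]) ds) \<and>
      v ds (map2 component (as[j := scale c x]) ds) = c * v ds (map2 component (as[j := x]) ds)"
      if "ds \<in> DS" for ds
    proof -
      have ds: "length ds = Suc n" "sum_list ds = m" using that by (auto simp: DS_def)
      show ?thesis
        using v[unfolded graded_multilinear_def, rule_format, of "map2 component as ds" ds j
            "component x (ds ! j)" "component y (ds ! j)" c] as ds hom[of as ds]
        by (simp add: upd component_add component_scale component_in)
    qed
    have "V (as[j := x + y]) = V (as[j := x]) + V (as[j := y])"
      unfolding V_def sum.distrib[symmetric] by (rule sum.cong) (use t in auto)
    moreover have "V (as[j := scale c x]) = c * V (as[j := x])"
      unfolding V_def sum_distrib_left by (rule sum.cong) (use t in auto)
    ultimately show "V (as[j := x + y]) - V (as[j := x]) - V (as[j := y]) \<in> {0} \<and>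
        V (as[j := scale c x]) - c * V (as[j := x]) \<in> {0}" by simp
  qed
  moreover have "module.subspace (*) {0::'k}"
  proof -
    interpret K: vector_space "(*) :: 'k \<Rightarrow> 'k \<Rightarrow> 'k" by (rule field_vs)
    show ?thesis by (rule K.subspace_single_0)
  qed
  ultimately have LR: "free_ext (*) V x = 0" if "x \<in> ?R" for x
    using free_ext_tensor_rel[OF field_vs] that by blast
  define g where "g X = (if X \<in> tensor_pow_deg (Suc n) m
    then free_ext (*) V (SOME x. X = x +o ?R) else 0)" for X
  have gx: "g (x +o ?R) = free_ext (*) V x" if "x \<in> deg_reps (Suc n) m" for x
  proof -
    define y where "y = (SOME y. x +o ?R = y +o ?R)"
    have "x +o ?R = y +o ?R" unfolding y_def by (rule someI[of _ x]) simp
    then have "free_ext (*) V x = free_ext (*) V y"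
      using LR[of "x - y"] by (simp add: coset_eq_iff[OF tensor_rel_subgroup] free_ext_diff[OF field_vs])
    then show ?thesis using that by (simp add: g_def y_def representatives_def)
  qed
  have gC: "g \<in> C n m"
    unfolding C_def Suc_eq_plus1[symmetric]
  proof (intro CollectI conjI ballI allI impI)
    fix X Y c assume X: "X \<in> tensor_pow_deg (Suc n) m"
    then obtain x where x: "X = x +o ?R" "x \<in> deg_reps (Suc n) m"
      unfolding tensor_pow_deg_def by (rule quot_obtain_representative)
    show "g (quot_scale free_scale ?R c X) = c * g X"
      using x free.subspace_scale[OF subspace_deg_reps x(2)]
      by (simp add: quot_scale_tensor_coset gx free_ext_scale[OF field_vs])
    assume Y: "Y \<in> tensor_pow_deg (Suc n) m"
    then obtain y where y: "Y = y +o ?R" "y \<in> deg_reps (Suc n) m"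
      unfolding tensor_pow_deg_def by (rule quot_obtain_representative)
    show "g (X + Y) = g X + g Y"
      using x y free.subspace_add[OF subspace_deg_reps x(2) y(2)]
      by (simp add: coset_plus[OF tensor_rel_subgroup] gx free_ext_add[OF field_vs])
  qed (simp add: g_def)
  have gv: "g (elem_tensor as) = v ds as"
    if as: "length as = Suc n" and h: "homog ds as" and s: "sum_list ds = m" for ds as
  proof -
    have len: "length ds = Suc n" using homog_length[OF h] as by simp
    have z: "v ds' (map2 component as ds') = 0" if "ds' \<in> DS - {ds}" for ds'
    proof -
      have ds': "length ds' = Suc n" "sum_list ds' = m" "ds' \<noteq> ds" using that by (auto simp: DS_def)
      then obtain j where j: "j < Suc n" "ds' ! j \<noteq> ds ! j"
        using len by (metis nth_equalityI)
      have "map2 component as ds' ! j = 0"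
        using j as ds' h component_homogeneous[of "as ! j" "ds ! j"] by (auto simp: homog_iff_nth)
      then show ?thesis
        using graded_multilinear_zero[OF v _ hom[OF as ds'(1)] ds'(2) j(1)] as ds' by simp
    qed
    have "map2 component as ds = as"
      using as len h component_homogeneous by (intro nth_equalityI) (auto simp: homog_iff_nth)
    then have "V as = v ds as"
      using sum.remove[OF fin, of ds "\<lambda>ds. v ds (map2 component as ds)"] z len s
      by (auto simp: V_def DS_def)
    then show ?thesis
      using gx[OF single_in_deg_reps[OF as h s], of 1] as
      by (simp add: elem_tensor_def free_ext_single[OF field_vs])
  qed
  have "cochain_of n m v = g"
    unfolding cochain_of_def Suc_eq_plus1[symmetric]
  proof (rule the_equality)
    show "g \<in> C n m \<and> (\<forall>ds as. length as = Suc n \<and> homog ds as \<and> sum_list ds = m \<longrightarrow>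
        g (elem_tensor as) = v ds as)" using gC gv by blast
    fix g' assume "g' \<in> C n m \<and> (\<forall>ds as. length as = Suc n \<and> homog ds as \<and> sum_list ds = m \<longrightarrow>
        g' (elem_tensor as) = v ds as)"
    then show "g' = g" using gC gv by (intro C_eqI[of g' n m g]) auto
  qed
  then show "cochain_of n m v \<in> C n m" and "length as = Suc n \<Longrightarrow> homog ds as \<Longrightarrow> sum_list ds = m \<Longrightarrow>
      cochain_of n m v (elem_tensor as) = v ds as" using gC gv by auto
qed

text \<open>
  Each summand in the values of \<open>b\<close>, \<open>\<tau>\<close> and \<open>s\<close> has this form, with a sign \<open>c\<close> and an
  operation \<open>\<sigma>\<close> on lists.
\<close>

lemma graded_multilinear_slotwise:
  assumes f: "f \<in> C n' m'" and \<sigma>: "slotwise n (Suc n') \<sigma>"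
    and hom: "\<And>ds as. length as = n \<Longrightarrow> homog ds as \<Longrightarrow> sum_list ds = m \<Longrightarrow>
      \<exists>ds'. homog ds' (\<sigma> as) \<and> sum_list ds' = m'"
  shows "graded_multilinear n m (\<lambda>ds as. c ds * f (elem_tensor (\<sigma> as)))"
  unfolding graded_multilinear_def
proof (intro allI impI, elim conjE)
  fix ds as j x y a
  assume as: "length as = n" "homog ds as" "sum_list ds = m" "j < n" "x \<in> A (ds ! j)" "y \<in> A (ds ! j)"
  let ?S = "\<lambda>z. Poly_Mapping.single (\<sigma> (as[j := z])) (1::'k)"
  let ?R = "tensor_rel (Suc n')"
  have len: "length (\<sigma> (as[j := z])) = Suc n'" for z using \<sigma> as by (simp add: slotwise_def)
  have reps: "?S z \<in> deg_reps (Suc n') m'" if "z \<in> A (ds ! j)" for z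
    using hom[of "as[j := z]" ds] homog_update[OF as(2) that, of] as(1,3) len single_in_deg_reps by auto
  have val: "f (elem_tensor (\<sigma> (as[j := z]))) = f (?S z +o ?R)" for z
    using elem_tensor_eq[OF len] by simp
  note ml = slotwise_multilinear_mod[OF \<sigma> multilinear_mod_single,
      unfolded multilinear_mod_def, rule_format, OF conjI[OF as(1,4)]]
  have "?S (x + y) +o ?R = (?S x + ?S y) +o ?R"
    using ml[of x y] by (simp add: coset_eq_iff[OF tensor_rel_subgroup] algebra_simps)
  moreover have "?S (scale a x) +o ?R = free_scale a (?S x) +o ?R"
    using ml[of x y a] by (simp add: coset_eq_iff[OF tensor_rel_subgroup])
  ultimately show "c ds * f (elem_tensor (\<sigma> (as[j := x + y]))) =
      c ds * f (elem_tensor (\<sigma> (as[j := x]))) + c ds * f (elem_tensor (\<sigma> (as[j := y]))) \<and>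
      c ds * f (elem_tensor (\<sigma> (as[j := scale a x]))) = a * (c ds * f (elem_tensor (\<sigma> (as[j := x]))))"
    unfolding val using C_add[OF f reps[OF as(5)] reps[OF as(6)]] C_scale[OF f reps[OF as(5)]]
    by (simp add: algebra_simps)
qed

lemma graded_multilinear_add:
  "graded_multilinear n m v \<Longrightarrow> graded_multilinear n m w \<Longrightarrow>
    graded_multilinear n m (\<lambda>ds as. v ds as + w ds as)"
  by (auto simp: graded_multilinear_def algebra_simps)

lemma graded_multilinear_sum:
  assumes "\<And>i. i \<in> I \<Longrightarrow> graded_multilinear n m (v i)"
  shows "graded_multilinear n m (\<lambda>ds as. \<Sum>i\<in>I. v i ds as)"
  using assms
  by (auto simp: graded_multilinear_def sum_distrib_left simp flip: sum.distrib intro!: sum.cong)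



subsection \<open>The differential on tensor powers\<close>

text \<open>
  The signs in the differential of a tensor power depend on the degrees of the factors; the
  grading involution produces them for arbitrary, not necessarily homogeneous, factors.
\<close>

definition diff_rep :: "nat \<Rightarrow> ('a list \<Rightarrow>\<^sub>0 'k) \<Rightarrow> ('a list \<Rightarrow>\<^sub>0 'k)" where
  "diff_rep n = free_ext free_scale (\<lambda>as. \<Sum>i<n. Poly_Mapping.single
     (map grading_involution (take i as) @ \<phi> (as ! i) # drop (Suc i) as) 1)"

lemma diff_rep_tensor_rel: "x \<in> tensor_rel n \<Longrightarrow> diff_rep n x \<in> tensor_rel n"
  unfolding diff_rep_def
proof (rule free_ext_tensor_rel[OF free_vs subspace_tensor_rel],
    rule multilinear_mod_sum[OF free_vs subspace_tensor_rel])
  fix i assume "i \<in> {..<n}"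
  then show "multilinear_mod n free_scale (tensor_rel n) (\<lambda>as. Poly_Mapping.single
      (map grading_involution (take i as) @ \<phi> (as ! i) # drop (Suc i) as) 1)"
    by (intro slotwise_multilinear_mod[OF slotwise_map_at multilinear_mod_single])
      (auto simp: \<phi>_add \<phi>_scale grading_involution_add grading_involution_scale)
qed auto

lemmas diff_rep_linear = free_ext_add[OF free_vs] free_ext_scale[OF free_vs]
  free_ext_diff[OF free_vs] free_ext_single[OF free_vs]

text \<open>
  On homogeneous factors the grading involution is a scalar \<open>\<plusminus> 1\<close>; these scalars are moved out of
  the tensor one by one, starting with the leftmost factor.
\<close>

lemma involution_prefix:
  assumes "homog ds xs" "length zs + length xs + length ys = n"
  shows "Poly_Mapping.single (zs @ map grading_involution xs @ ys) 1
    - Poly_Mapping.single (zs @ xs @ ys) ((-1) ^ sum_list ds) \<in> tensor_rel n"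
  using assms unfolding homog_def
proof (induction ds xs arbitrary: zs rule: list_all2_induct)
  case Nil
  then show ?case by (simp add: free.subspace_0[OF subspace_tensor_rel])
next
  case (Cons d ds x xs)
  let ?c = "(-1) ^ d :: 'k"
  let ?rest = "map grading_involution xs @ ys"
  have 1: "Poly_Mapping.single (zs @ scale ?c x # ?rest) 1
      - free_scale ?c (Poly_Mapping.single (zs @ x # ?rest) 1) \<in> tensor_rel n"
    using multilinear_mod_single[of n, unfolded multilinear_mod_def, rule_format,
        of "zs @ x # ?rest" "length zs" x x ?c] Cons.prems by simp
  have "Poly_Mapping.single ((zs @ [x]) @ ?rest) 1
      - Poly_Mapping.single ((zs @ [x]) @ xs @ ys) ((-1) ^ sum_list ds) \<in> tensor_rel n"
    by (rule Cons.IH) (use Cons.prems in simp)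
  then have "free_scale ?c (Poly_Mapping.single (zs @ x # ?rest) 1
      - Poly_Mapping.single (zs @ x # xs @ ys) ((-1) ^ sum_list ds)) \<in> tensor_rel n"
    using free.subspace_scale[OF subspace_tensor_rel] by simp
  from free.subspace_add[OF subspace_tensor_rel 1 this]
  show ?case
    using Cons.hyps
    by (simp add: grading_involution_homogeneous free.scale_right_diff_distrib free_scale_single power_add)
qed

lemma diff_rep_homogeneous:
  assumes as: "length as = n" "homog ds as"
  shows "diff_rep n (Poly_Mapping.single as 1)
    - (\<Sum>i<n. Poly_Mapping.single (as[i := \<phi> (as ! i)]) ((-1) ^ sum_list (take i ds))) \<in> tensor_rel n"
proof -
  have "Poly_Mapping.single (map grading_involution (take i as) @ \<phi> (as ! i) # drop (Suc i) as) 1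
      - Poly_Mapping.single (as[i := \<phi> (as ! i)]) ((-1) ^ sum_list (take i ds)) \<in> tensor_rel n"
    if "i < n" for i
    using involution_prefix[of "take i ds" "take i as" "[]" "\<phi> (as ! i) # drop (Suc i) as" n] as that
    by (simp add: upd_conv_take_nth_drop homog_def list_all2_takeI)
  then show ?thesis
    by (simp add: diff_rep_def diff_rep_linear flip: sum_subtractf)
      (intro free.subspace_sum[OF subspace_tensor_rel], simp)
qed

lemma diff_rep_pow_reps: "x \<in> pow_reps n \<Longrightarrow> diff_rep n x \<in> pow_reps n"
proof -
  let ?E = "{x. diff_rep n x \<in> pow_reps n}"
  have "free.subspace ?E"
    unfolding diff_rep_def by (rule free_ext_subspace_vimage[OF free_vs subspace_pow_reps])
  moreover have "{Poly_Mapping.single as 1 | as. length as = n} \<subseteq> ?E"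
    by (auto simp: diff_rep_def diff_rep_linear
        intro!: free.subspace_sum[OF subspace_pow_reps] single_in_pow_reps)
  moreover have "tensor_rel n \<subseteq> ?E" using diff_rep_tensor_rel tensor_rel_pow_reps by blast
  ultimately have "pow_reps n \<subseteq> ?E"
    using representatives_span_minimal by (simp add: tensor_pow_def)
  then show "x \<in> pow_reps n \<Longrightarrow> diff_rep n x \<in> pow_reps n" by blast
qed

lemma single_sum_entry:
  assumes "finite S" "length xs + length ys + 1 = n"
  shows "Poly_Mapping.single (xs @ (\<Sum>m\<in>S. f m) # ys) 1
    - (\<Sum>m\<in>S. Poly_Mapping.single (xs @ f m # ys) 1) \<in> tensor_rel n"
  using assms(1)
proof (induction rule: finite_induct)
  case empty
  then show ?case
    using single_zero_in_tensor_rel[of "xs @ 0 # ys" n "length xs" 1] assms(2) by simp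
next
  case (insert i S)
  have "Poly_Mapping.single (xs @ (f i + (\<Sum>m\<in>S. f m)) # ys) 1 - Poly_Mapping.single (xs @ f i # ys) 1
      - Poly_Mapping.single (xs @ (\<Sum>m\<in>S. f m) # ys) 1 \<in> tensor_rel n"
    using multilinear_mod_single[of n, unfolded multilinear_mod_def, rule_format,
        of "xs @ 0 # ys" "length xs" "f i" "\<Sum>m\<in>S. f m"] assms(2) by simp
  from free.subspace_add[OF subspace_tensor_rel this insert.IH]
  show ?case using insert.hyps by (simp add: algebra_simps)
qed

text \<open>One factor after the other is expanded into its homogeneous components.\<close>

lemma homogeneous_singles_span:
  assumes E: "free.subspace E" "tensor_rel n \<subseteq> E"
    and hom: "\<And>ds as. length as = n \<Longrightarrow> homog ds as \<Longrightarrow> Poly_Mapping.single as 1 \<in> E"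
  shows "length as = n \<Longrightarrow> Poly_Mapping.single as 1 \<in> E"
proof -
  have "Poly_Mapping.single (xs @ ys) 1 \<in> E" if "homog ds xs" "length xs + length ys = n" for ds xs ys
    using that
  proof (induction ys arbitrary: ds xs)
    case Nil
    then show ?case using hom by auto
  next
    case (Cons y ys)
    let ?S = "{m. component y m \<noteq> 0}"
    have "Poly_Mapping.single (xs @ component y m # ys) 1 \<in> E" for m
      using Cons.IH[of "ds @ [m]" "xs @ [component y m]"] Cons.prems
      by (simp add: homog_def list_all2_appendI component_in)
    then have "(\<Sum>m\<in>?S. Poly_Mapping.single (xs @ component y m # ys) 1) \<in> E"
      by (intro free.subspace_sum[OF E(1)])
    moreover have "Poly_Mapping.single (xs @ y # ys) 1
        - (\<Sum>m\<in>?S. Poly_Mapping.single (xs @ component y m # ys) 1) \<in> E"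
      using single_sum_entry[OF finite_component[of y], of xs ys n "component y"] Cons.prems E(2)
      by (auto simp: sum_component)
    ultimately show ?case using free.subspace_add[OF E(1)] by force
  qed
  from this[of "[]" "[]" as] show "length as = n \<Longrightarrow> Poly_Mapping.single as 1 \<in> E"
    by (simp add: homog_def)
qed

text \<open>
  The map induced by \<open>diff_rep\<close> has the values that characterize \<open>tensor_diff\<close>, and it is the
  only such map because the tensors of homogeneous elements span.
\<close>

lemma tensor_diff_coset:
  assumes "x \<in> pow_reps n"
  shows "tensor_diff n (x +o tensor_rel n) = diff_rep n x +o tensor_rel n"
proof -
  let ?R = "tensor_rel n"
  let ?lin = "quot_linear free_scale ?R (tensor_pow n) free_scale ?R (tensor_pow n)"
  define D where "D X = (if X \<in> tensor_pow n then diff_rep n (SOME x. X = x +o ?R) +o ?R else undefined)" for X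
  have Dx: "D (x +o ?R) = diff_rep n x +o ?R" if "x \<in> pow_reps n" for x
  proof -
    define y where "y = (SOME y. x +o ?R = y +o ?R)"
    have "x +o ?R = y +o ?R" unfolding y_def by (rule someI[of _ x]) simp
    then have "diff_rep n x +o ?R = diff_rep n y +o ?R"
      using diff_rep_tensor_rel[of "x - y"]
      by (simp add: coset_eq_iff[OF tensor_rel_subgroup] diff_rep_def diff_rep_linear)
    then show ?thesis using that by (simp add: D_def y_def representatives_def)
  qed
  have lin: "?lin D"
    unfolding quot_linear_def
  proof (intro conjI ballI allI)
    fix X Y c assume X: "X \<in> tensor_pow n"
    then obtain x where x: "X = x +o ?R" "x \<in> pow_reps n"
      unfolding tensor_pow_def by (rule quot_obtain_representative)
    show "D X \<in> tensor_pow n" using x diff_rep_pow_reps[OF x(2)] Dx by (simp add: representatives_def)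
    show "D (quot_scale free_scale ?R c X) = quot_scale free_scale ?R c (D X)"
      using x free.subspace_scale[OF subspace_pow_reps x(2)]
      by (simp add: quot_scale_tensor_coset Dx diff_rep_def diff_rep_linear)
    assume Y: "Y \<in> tensor_pow n"
    then obtain y where y: "Y = y +o ?R" "y \<in> pow_reps n"
      unfolding tensor_pow_def by (rule quot_obtain_representative)
    show "D (X + Y) = D X + D Y"
      using x y free.subspace_add[OF subspace_pow_reps x(2) y(2)]
      by (simp add: coset_plus[OF tensor_rel_subgroup] Dx diff_rep_def diff_rep_linear)
  qed
  have val: "D (elem_tensor as) = (\<Sum>i<n. Poly_Mapping.single (as[i := \<phi> (as ! i)])
      ((-1) ^ sum_list (take i ds))) +o ?R" if "length as = n" "homog ds as" for ds as
    using Dx[OF single_in_pow_reps[OF that(1), of 1]] that(1) diff_rep_homogeneous[OF that]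
    by (simp add: elem_tensor_def coset_eq_iff[OF tensor_rel_subgroup])
  have "tensor_diff n = D"
    unfolding tensor_diff_def
  proof (rule the_equality, intro conjI)
    show "D \<in> extensional (tensor_pow n)" by (simp add: D_def extensional_def)
    show "?lin D" by (rule lin)
    show "\<forall>ds as. length as = n \<and> homog ds as \<longrightarrow> D (elem_tensor as) =
        (\<Sum>i<n. Poly_Mapping.single (as[i := \<phi> (as ! i)]) ((-1) ^ sum_list (take i ds))) +o ?R"
      using val by blast
  next
    fix D' assume D': "D' \<in> extensional (tensor_pow n) \<and> ?lin D' \<and>
      (\<forall>ds as. length as = n \<and> homog ds as \<longrightarrow> D' (elem_tensor as) =
        (\<Sum>i<n. Poly_Mapping.single (as[i := \<phi> (as ! i)]) ((-1) ^ sum_list (take i ds))) +o ?R)"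
    let ?E = "{x \<in> pow_reps n. D' (x +o ?R) = D (x +o ?R)}"
    have add: "G ((x + y) +o ?R) = G (x +o ?R) + G (y +o ?R)"
      and scl: "G (free_scale c x +o ?R) = quot_scale free_scale ?R c (G (x +o ?R))"
      if "?lin G" "x \<in> pow_reps n" "y \<in> pow_reps n" for G x y c
      using that
      by (auto simp: quot_linear_def representatives_def simp flip: coset_plus[OF tensor_rel_subgroup]
          quot_scale_tensor_coset)
    have zero: "G (z +o ?R) = ?R" if G: "?lin G" and z: "z \<in> ?R" for G z
    proof -
      have z': "z \<in> pow_reps n" using z tensor_rel_pow_reps by blast
      have "z +o ?R \<in> tensor_pow n" using z' by (simp add: representatives_def)
      then have "G (z +o ?R) \<in> tensor_pow n" using G by (auto simp: quot_linear_def)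
      then obtain w where w: "G (z +o ?R) = w +o ?R" by (auto simp: tensor_pow_def quot_def)
      have "z +o ?R = free_scale 0 z +o ?R"
        using z coset_eq_iff[OF tensor_rel_subgroup, of z n 0] by simp
      then have "G (z +o ?R) = quot_scale free_scale ?R 0 (G (z +o ?R))"
        using scl[OF G z' z', of 0] by simp
      then show ?thesis by (simp add: w quot_scale_tensor_coset coset_zero)
    qed
    have "free.subspace ?E"
      using subspace_pow_reps[of n] lin D' zero[OF lin, of 0] zero[of D' 0]
        free.subspace_0[OF subspace_tensor_rel, of n]
      by (auto simp: free.subspace_def add scl)
    moreover have RE: "?R \<subseteq> ?E" using tensor_rel_pow_reps zero[OF lin] zero[of D'] D' by auto
    moreover have "Poly_Mapping.single as 1 \<in> ?E" if "length as = n" for as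
    proof (rule homogeneous_singles_span[OF calculation _ that])
      fix ds as assume "length as = n" "homog ds as"
      then show "Poly_Mapping.single as 1 \<in> ?E"
        using D' val single_in_pow_reps by (simp flip: elem_tensor_eq)
    qed
    ultimately have "pow_reps n \<subseteq> ?E"
      using representatives_span_minimal[of ?E "{Poly_Mapping.single as 1 | as. length as = n}" n]
      unfolding tensor_pow_def by blast
    then have "D' X = D X" if "X \<in> tensor_pow n" for X
      using that quot_obtain_representative unfolding tensor_pow_def by blast
    then show "D' = D" using D' by (intro extensionalityI[of _ "tensor_pow n"]) (auto simp: D_def extensional_def)
  qed
  then show ?thesis using Dx[OF assms] by simp
qed

lemma homog_\<phi>:
  assumes "homog ds as" "i < length as" "ds ! i = Suc d"
  shows "homog (ds[i := d]) (as[i := \<phi> (as ! i)])" "Suc (sum_list (ds[i := d])) = sum_list ds"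
proof -
  show "homog (ds[i := d]) (as[i := \<phi> (as ! i)])"
    using assms \<phi>_A_Suc[of "as ! i" d] by (auto simp: homog_iff_nth nth_list_update)
  have "ds = take i ds @ Suc d # drop (Suc i) ds"
    using assms homog_length[OF assms(1)] by (metis id_take_nth_drop)
  then have "sum_list ds = sum_list (take i ds @ Suc d # drop (Suc i) ds)" by simp
  then show "Suc (sum_list (ds[i := d])) = sum_list ds"
    using assms homog_length[OF assms(1)] by (simp add: upd_conv_take_nth_drop)
qed

text \<open>
  A factor of degree \<open>0\<close> has no degree to lose, but then \<open>\<phi>\<close> kills it and the tensor vanishes.
\<close>

lemma \<phi>_entry_in_deg_reps:
  assumes as: "length as = n" "homog ds as" "sum_list ds = Suc m" and i: "i < n"
  shows "Poly_Mapping.single (as[i := \<phi> (as ! i)]) c \<in> deg_reps n m"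
proof (cases "ds ! i")
  case 0
  then have "\<phi> (as ! i) = 0" using as i \<phi>_A_0[of "as ! i"] by (auto simp: homog_iff_nth)
  then have "Poly_Mapping.single (as[i := \<phi> (as ! i)]) c \<in> tensor_rel n"
    using as i by (intro single_zero_in_tensor_rel[of _ n i]) auto
  then show ?thesis using tensor_rel_deg_reps by blast
next
  case (Suc d)
  then show ?thesis using homog_\<phi>[OF as(2) _ Suc] as i by (intro single_in_deg_reps) auto
qed

lemma diff_rep_deg_reps: "x \<in> deg_reps n (Suc m) \<Longrightarrow> diff_rep n x \<in> deg_reps n m"
proof -
  let ?E = "{x. diff_rep n x \<in> deg_reps n m}"
  have "free.subspace ?E"
    unfolding diff_rep_def by (rule free_ext_subspace_vimage[OF free_vs subspace_deg_reps])
  moreover have "diff_rep n (Poly_Mapping.single as 1) \<in> deg_reps n m"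
    if as: "length as = n" "homog ds as" "sum_list ds = Suc m" for ds as
  proof -
    let ?S = "\<Sum>i<n. Poly_Mapping.single (as[i := \<phi> (as ! i)]) ((-1) ^ sum_list (take i ds))"
    have "?S \<in> deg_reps n m"
      using \<phi>_entry_in_deg_reps[OF as] by (intro free.subspace_sum[OF subspace_deg_reps]) simp
    moreover have "diff_rep n (Poly_Mapping.single as 1) - ?S \<in> deg_reps n m"
      using diff_rep_homogeneous[OF as(1,2)] tensor_rel_deg_reps by blast
    ultimately show ?thesis using free.subspace_add[OF subspace_deg_reps] by force
  qed
  moreover have "tensor_rel n \<subseteq> ?E" using diff_rep_tensor_rel tensor_rel_deg_reps by blast
  ultimately have "deg_reps n (Suc m) \<subseteq> ?E"
    unfolding tensor_pow_deg_def[of n "Suc m"] by (intro representatives_span_minimal) auto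
  then show "x \<in> deg_reps n (Suc m) \<Longrightarrow> diff_rep n x \<in> deg_reps n m" by blast
qed

end

section \<open>Identities of the cyclic operators\<close>

subsection \<open>Formal consequences of the cosimplicial relations\<close>

lemma additive_funpow:
  fixes u :: "'v::ab_group_add \<Rightarrow> 'v"
  assumes "additive u" shows "additive (u ^^ k)"
proof -
  have "(u ^^ k) (x + y) = (u ^^ k) x + (u ^^ k) y" for x y
    by (induction k) (simp_all add: additive.add[OF assms])
  then show ?thesis by (simp add: additive_def)
qed

lemma sum_fun_apply: "(\<Sum>i\<in>I. f i) x = (\<Sum>i\<in>I. f i x)"
  by (induction I rule: infinite_finite_induct) simp_all

text \<open>
  Here \<open>t\<close> and \<open>u\<close> are the signed cyclic operators on two consecutive cochain spaces and
  \<open>\<delta> i\<close> are the signed coface maps. In \<open>b = (\<Sum>i\<le>n. \<delta> i)\<close> only the last summand involves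
  the cyclic structure, and \<open>b'\<close> is \<open>b\<close> without it.
\<close>

context
  fixes n :: nat and \<delta> :: "nat \<Rightarrow> 'u::ab_group_add \<Rightarrow> 'v::ab_group_add"
    and t :: "'u \<Rightarrow> 'u" and u :: "'v \<Rightarrow> 'v"
  assumes u: "additive u"
    and step: "\<And>i f. i < n \<Longrightarrow> u (\<delta> (Suc i) f) = \<delta> i (t f)"
    and last: "\<And>f. \<delta> n f = u (\<delta> 0 f)"
begin

text \<open>
  The identity \<open>(1 - \<tau>) b = b' (1 - \<tau>)\<close>: applying \<open>u\<close> shifts the cofaces down by one, and the
  summand that \<open>u\<close> produces from \<open>\<delta> 0\<close> is the one that \<open>b'\<close> lacks, \<open>\<delta> n\<close>.
\<close>

lemma coface_sum_minus_cyclic: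
  "(\<Sum>i\<le>n. \<delta> i f) - u (\<Sum>i\<le>n. \<delta> i f) = (\<Sum>i<n. \<delta> i f) - (\<Sum>i<n. \<delta> i (t f))"
proof -
  have "u (\<Sum>i\<le>n. \<delta> i f) = (\<Sum>i\<le>n. u (\<delta> i f))" by (rule additive.sum[OF u])
  also have "\<dots> = u (\<delta> 0 f) + (\<Sum>i<n. u (\<delta> (Suc i) f))"
    by (simp add: sum.lessThan_Suc_shift flip: lessThan_Suc_atMost del: sum.lessThan_Suc)
  also have "\<dots> = \<delta> n f + (\<Sum>i<n. \<delta> i (t f))" by (simp add: step last)
  finally show ?thesis by (simp flip: lessThan_Suc_atMost)
qed

text \<open>
  Moving \<open>k\<close> cyclic operators through \<open>b\<close> shifts each coface; those that run past
  \<open>\<delta> n\<close> reappear at the other end with one additional cyclic operator. The two groups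
  are arranged so that the sum over \<open>k\<close> telescopes.
\<close>

lemma coface_sum_cyclic_power:
  assumes "k < n"
  shows "(\<Sum>i\<le>n. \<delta> i ((t ^^ k) f)) =
    (u ^^ k) ((\<Sum>i<n. \<delta> i f) - (\<Sum>i<k. \<delta> i f)) + (u ^^ Suc k) (\<Sum>i<Suc k. \<delta> i f)"
  using assms
proof (induction k arbitrary: f)
  case 0
  then show ?case using last by (simp flip: lessThan_Suc_atMost)
next
  case (Suc k)
  interpret U: additive u by (rule u)
  interpret Uk: additive "u ^^ k" by (rule additive_funpow[OF u])
  have shift: "(\<Sum>i<l. \<delta> i (t f)) = u ((\<Sum>i<Suc l. \<delta> i f) - \<delta> 0 f)" if "l \<le> n" for l
  proof -
    have "(\<Sum>i<l. \<delta> i (t f)) = (\<Sum>i<l. u (\<delta> (Suc i) f))"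
      using step that by (intro sum.cong) auto
    then show ?thesis by (simp add: U.sum sum.lessThan_Suc_shift del: sum.lessThan_Suc)
  qed
  have "(\<Sum>i\<le>n. \<delta> i ((t ^^ Suc k) f)) = (\<Sum>i\<le>n. \<delta> i ((t ^^ k) (t f)))"
    by (simp add: funpow_swap1)
  also have "\<dots> = (u ^^ k) ((\<Sum>i<n. \<delta> i (t f)) - (\<Sum>i<k. \<delta> i (t f)))
      + (u ^^ Suc k) (\<Sum>i<Suc k. \<delta> i (t f))" using Suc by (intro Suc.IH) simp
  also have "(\<Sum>i<n. \<delta> i (t f)) - (\<Sum>i<k. \<delta> i (t f))
      = u (((\<Sum>i<n. \<delta> i f) - (\<Sum>i<Suc k. \<delta> i f)) + u (\<delta> 0 f))"
    using Suc.prems by (simp only: shift less_imp_le order_refl Suc_lessD flip: U.diff)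
      (simp add: last algebra_simps)
  also have "(\<Sum>i<Suc k. \<delta> i (t f)) = u ((\<Sum>i<Suc (Suc k). \<delta> i f) - \<delta> 0 f)"
    using Suc.prems by (intro shift) simp
  finally show ?case
    by (simp add: funpow_swap1 U.add U.diff Uk.add Uk.diff del: sum.lessThan_Suc)
qed

text \<open>
  The identity \<open>b N = N b'\<close>. The cyclic operator has order \<open>n\<close> on the source of \<open>b\<close> and order
  \<open>n + 1\<close> on its target, hence the different ranges of \<open>k\<close>.
\<close>

lemma coface_sum_norm:
  "(\<Sum>k<n. \<Sum>i\<le>n. \<delta> i ((t ^^ k) f)) = (\<Sum>k\<le>n. (u ^^ k) (\<Sum>i<n. \<delta> i f))"
proof -
  let ?P = "\<lambda>k. \<Sum>i<k. \<delta> i f"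
  have "(\<Sum>k<n. \<Sum>i\<le>n. \<delta> i ((t ^^ k) f))
      = (\<Sum>k<n. (u ^^ k) (?P n) + ((u ^^ Suc k) (?P (Suc k)) - (u ^^ k) (?P k)))"
    by (intro sum.cong refl, subst coface_sum_cyclic_power)
      (simp_all add: additive.diff[OF additive_funpow[OF u]] del: sum.lessThan_Suc funpow.simps)
  also have "\<dots> = (\<Sum>k<n. (u ^^ k) (?P n)) + ((u ^^ n) (?P n) - (u ^^ 0) (?P 0))"
    using sum_lessThan_telescope[of "\<lambda>k. (u ^^ k) (?P k)" n]
    by (simp only: sum.distrib)
  finally show ?thesis
    using additive.zero[OF additive_funpow[OF u]] by (simp flip: lessThan_Suc_atMost)
qed

end


subsection \<open>The operators on functions of homogeneous lists\<close>

context dga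
begin

text \<open>
  A cochain is determined by its values on tensors of homogeneous elements. In terms of these
  values, every operator becomes an explicit formula in lists of elements paired with their
  degrees. All functions are cut off outside the lists of the given length and total degree,
  so that the identities below are equalities of functions.
\<close>

definition homog_list :: "nat \<Rightarrow> nat \<Rightarrow> (nat \<times> 'a) list \<Rightarrow> bool" where
  "homog_list n m xs \<longleftrightarrow> length xs = Suc n \<and> (\<forall>x\<in>set xs. snd x \<in> A (fst x)) \<and> sum_list (map fst xs) = m"

definition merge_at :: "nat \<Rightarrow> (nat \<times> 'a) list \<Rightarrow> (nat \<times> 'a) list" where
  "merge_at i xs =
     take i xs @ (fst (xs ! i) + fst (xs ! Suc i), snd (xs ! i) * snd (xs ! Suc i)) # drop (i + 2) xs"

text \<open>
  The signed cyclic operator \<open>\<tau>\<close>. If the last entry has degree \<open>d\<close>, then \<open>\<gamma> = d (m - d)\<close>, which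
  has the parity of \<open>(m + 1) d\<close>. In this form the sign is additive in the degree of the moved
  entry, which makes powers of the operator and products of entries easy to handle.
\<close>

definition cyc :: "nat \<Rightarrow> nat \<Rightarrow> ((nat \<times> 'a) list \<Rightarrow> 'k) \<Rightarrow> (nat \<times> 'a) list \<Rightarrow> 'k" where
  "cyc n m w xs = (if homog_list n m xs
     then (-1) ^ (n + Suc m * fst (last xs)) * w (last xs # butlast xs) else 0)"

definition coface :: "nat \<Rightarrow> nat \<Rightarrow> nat \<Rightarrow> ((nat \<times> 'a) list \<Rightarrow> 'k) \<Rightarrow> (nat \<times> 'a) list \<Rightarrow> 'k" where
  "coface n m i w xs = (if homog_list (Suc n) m xs then (-1) ^ i * w (merge_at i xs) else 0)"

text \<open>
  The operator \<open>s\<close>, which inserts the unit.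
\<close>

definition extra_degen :: "nat \<Rightarrow> nat \<Rightarrow> ((nat \<times> 'a) list \<Rightarrow> 'k) \<Rightarrow> (nat \<times> 'a) list \<Rightarrow> 'k" where
  "extra_degen n m w xs = (if homog_list n m xs then (-1) ^ n * w (xs @ [(0, 1)]) else 0)"

text \<open>
  One summand of the internal differential. An entry of degree \<open>0\<close> is killed by \<open>\<phi>\<close>, so the
  value there is \<open>0\<close>; the case distinction avoids a degree below \<open>0\<close>.
\<close>

definition lower_at :: "nat \<Rightarrow> ((nat \<times> 'a) list \<Rightarrow> 'k) \<Rightarrow> (nat \<times> 'a) list \<Rightarrow> 'k" where
  "lower_at i w xs = (case fst (xs ! i) of 0 \<Rightarrow> 0 | Suc d \<Rightarrow> w (xs[i := (d, \<phi> (snd (xs ! i)))]))"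

definition codiff :: "nat \<Rightarrow> nat \<Rightarrow> ((nat \<times> 'a) list \<Rightarrow> 'k) \<Rightarrow> (nat \<times> 'a) list \<Rightarrow> 'k" where
  "codiff n m w xs = (if homog_list n (Suc m) xs
     then (-1) ^ m * (\<Sum>i<Suc n. (-1) ^ sum_list (map fst (take i xs)) * lower_at i w xs) else 0)"

text \<open>
  The operator \<open>b\<close>: its last summand, which involves \<open>a\<^sub>n a\<^sub>0\<close>, is the rotated zeroth one.
\<close>

definition hochschild :: "nat \<Rightarrow> nat \<Rightarrow> ((nat \<times> 'a) list \<Rightarrow> 'k) \<Rightarrow> (nat \<times> 'a) list \<Rightarrow> 'k" where
  "hochschild n m w = (\<Sum>i<Suc n. coface n m i w) + cyc (Suc n) m (coface n m 0 w)"

definition connes :: "nat \<Rightarrow> nat \<Rightarrow> ((nat \<times> 'a) list \<Rightarrow> 'k) \<Rightarrow> (nat \<times> 'a) list \<Rightarrow> 'k" where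
  "connes n m w = (\<Sum>i\<le>n. (cyc n m ^^ i) (extra_degen n m (w - cyc (Suc n) m w)))"

lemma lower_at_add: "lower_at i (v + w) xs = lower_at i v xs + lower_at i w xs"
  by (simp add: lower_at_def split: nat.split)

lemma additive_operators:
  shows additive_cyc: "additive (cyc n m)" and additive_coface: "additive (coface n m i)"
    and additive_codiff: "additive (codiff n m)"
  by (simp_all add: additive_def fun_eq_iff cyc_def coface_def codiff_def lower_at_add
      distrib_left sum.distrib del: sum.lessThan_Suc)

lemmas additive_cyc_power = additive_funpow[OF additive_cyc]

lemma homog_list_rotate: "homog_list n m (xs @ [x]) \<longleftrightarrow> homog_list n m (x # xs)"
  by (auto simp: homog_list_def)

lemma homog_list_cyc: "homog_list n m xs \<Longrightarrow> homog_list n m (last xs # butlast xs)"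
  using homog_list_rotate[of n m "butlast xs" "last xs"]
  by (cases "xs = []") (auto simp: homog_list_def)

lemma homog_list_merge:
  assumes "homog_list (Suc n) m xs" "i < Suc n"
  shows "homog_list n m (merge_at i xs)"
proof -
  have "xs = take i xs @ xs ! i # xs ! Suc i # drop (i + 2) xs"
    using assms by (metis Cons_nth_drop_Suc Suc_less_eq add_2_eq_Suc' homog_list_def id_take_nth_drop less_SucI)
  then obtain us x y vs where xs: "xs = us @ x # y # vs" "length us = i"
    using assms by (metis homog_list_def length_take less_SucI min.absorb4)
  then have "merge_at i xs = us @ (fst x + fst y, snd x * snd y) # vs"
    by (auto simp: merge_at_def nth_append)
  then show ?thesis using assms(1) mult_A xs by (auto simp: homog_list_def)
qed

lemma homog_list_one: "homog_list (Suc n) m (xs @ [(0, 1)]) \<longleftrightarrow> homog_list n m xs"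
  by (auto simp: homog_list_def one_in_A_0)

lemma homog_list_lower:
  assumes "homog_list n (Suc m) xs" "i < Suc n" "fst (xs ! i) = Suc d"
  shows "homog_list n m (xs[i := (d, \<phi> (snd (xs ! i)))])"
proof -
  have "xs = take i xs @ xs ! i # drop (Suc i) xs"
    using assms by (simp add: homog_list_def id_take_nth_drop)
  then obtain us a vs where xs: "xs = us @ (Suc d, a) # vs" "length us = i"
    using assms by (metis homog_list_def length_take min.absorb4 prod.collapse)
  then show ?thesis using assms(1) \<phi>_A_Suc[of a d] by (auto simp: homog_list_def)
qed

lemma merge_at_snoc: "Suc i < length xs \<Longrightarrow> merge_at i (xs @ [x]) = merge_at i xs @ [x]"
  by (simp add: merge_at_def nth_append)

lemma cyc_snoc:
  "cyc n m w (xs @ [x]) = (if homog_list n m (xs @ [x]) then (-1) ^ (n + Suc m * fst x) * w (x # xs) else 0)"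
  by (simp add: cyc_def)

lemma homog_list_snocE:
  assumes "homog_list n m xs"
  obtains ys x where "xs = ys @ [x]" "length ys = n"
  using assms by (cases xs rule: rev_cases) (auto simp: homog_list_def)

lemma minus_one_power_cong: "even (a + b) \<Longrightarrow> (-1) ^ a = ((-1) ^ b :: 'k)"
  by (auto simp: minus_one_power_iff)

text \<open>
  Rotating by one position turns the product of two adjacent inner entries into the product one
  position earlier. The two lemmas below are the relations assumed for \<open>\<delta>\<close>, \<open>t\<close> and \<open>u\<close> above; the
  second one treats the coface whose product contains the entries from both ends.
\<close>

lemma cyc_coface_Suc:
  assumes i: "i < n"
  shows "cyc (Suc n) m (coface n m (Suc i) w) = coface n m i (cyc n m w)"
proof
  fix xs
  show "cyc (Suc n) m (coface n m (Suc i) w) xs = coface n m i (cyc n m w) xs"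
  proof (cases "homog_list (Suc n) m xs")
    case True
    then obtain ys z where xs: "xs = ys @ [z]" "length ys = Suc n" by (rule homog_list_snocE)
    have m: "merge_at (Suc i) (z # ys) = z # merge_at i ys" by (simp add: merge_at_def)
    have m': "merge_at i xs = merge_at i ys @ [z]" using xs i by (simp add: merge_at_snoc)
    have h: "homog_list n m (merge_at i ys @ [z])" using homog_list_merge[OF True, of i] i m' by simp
    have "homog_list (Suc n) m (z # ys)" using True by (simp add: xs homog_list_rotate)
    then have "cyc (Suc n) m (coface n m (Suc i) w) xs
        = (-1) ^ (Suc n + Suc m * fst z) * ((-1) ^ Suc i * w (z # merge_at i ys))"
      using True by (simp only: xs(1) cyc_snoc coface_def m if_True)
    moreover have "coface n m i (cyc n m w) xs
        = (-1) ^ i * ((-1) ^ (n + Suc m * fst z) * w (z # merge_at i ys))"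
      using True h by (simp only: m' cyc_snoc coface_def if_True)
    ultimately show ?thesis by (simp add: power_add mult.left_commute)
  qed (simp add: cyc_def coface_def)
qed

lemma cyc_cyc_coface:
  "cyc (Suc n) m (cyc (Suc n) m (coface n m 0 w)) = coface n m n (cyc n m w)"
proof
  fix xs
  show "cyc (Suc n) m (cyc (Suc n) m (coface n m 0 w)) xs = coface n m n (cyc n m w) xs"
  proof (cases "homog_list (Suc n) m xs")
    case True
    then obtain us z where us: "xs = us @ [z]" "length us = Suc n" by (rule homog_list_snocE)
    then obtain ys y where ys: "us = ys @ [y]" "length ys = n" by (cases us rule: rev_cases) auto
    have xs: "xs = ys @ [y, z]" using us ys by simp
    let ?yz = "(fst y + fst z, snd y * snd z)"
    have m: "merge_at n xs = ys @ [?yz]" using xs ys by (simp add: merge_at_def nth_append)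
    have m0: "merge_at 0 (y # z # ys) = ?yz # ys" by (simp add: merge_at_def)
    have h1: "homog_list (Suc n) m (z # ys @ [y])" "homog_list (Suc n) m (us @ [z])"
      "homog_list (Suc n) m (y # z # ys)"
      using True by (auto simp: xs us ys homog_list_def)
    have h2: "homog_list n m (ys @ [?yz])" using homog_list_merge[OF True, of n] m by simp
    have "cyc (Suc n) m (cyc (Suc n) m (coface n m 0 w)) xs
        = (-1) ^ (Suc n + Suc m * fst z) * ((-1) ^ (Suc n + Suc m * fst y) * w (?yz # ys))"
    proof -
      have "cyc (Suc n) m (coface n m 0 w) ((z # ys) @ [y]) = (-1) ^ (Suc n + Suc m * fst y) * w (?yz # ys)"
        by (rule trans[OF cyc_snoc]) (use h1 in \<open>simp add: coface_def m0\<close>)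
      then show ?thesis
        using trans[OF cyc_snoc if_P[OF h1(2)], of "cyc (Suc n) m (coface n m 0 w)"]
        by (simp only: us(1) ys(1) append_Cons append_Nil append_assoc)
    qed
    moreover have "coface n m n (cyc n m w) xs = (-1) ^ n * ((-1) ^ (n + Suc m * (fst y + fst z)) * w (?yz # ys))"
      using True h2 by (simp add: coface_def m cyc_snoc)
    moreover have "(-1) ^ (Suc n + Suc m * fst z) * (-1) ^ (Suc n + Suc m * fst y)
        = ((-1) ^ n * (-1) ^ (n + Suc m * (fst y + fst z)) :: 'k)"
      unfolding power_add[symmetric] by (rule minus_one_power_cong) auto
    ultimately show ?thesis by (simp add: mult.assoc[symmetric])
  qed (simp add: cyc_def coface_def)
qed

text \<open>
  Multiplying the inserted unit into its left neighbour gives back the argument; all other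
  multiplications happen away from the unit and cancel because \<open>s\<close> changes sign with \<open>n\<close>.
  For \<open>n = 0\<close> the second sum is empty.
\<close>

lemma extra_degen_homotopy:
  "extra_degen n m (\<Sum>i<Suc n. coface n m i w) + (\<Sum>i<n. coface (n - 1) m i (extra_degen (n - 1) m w))
    = (\<lambda>xs. if homog_list n m xs then w xs else 0)"
proof
  fix xs
  show "(extra_degen n m (\<Sum>i<Suc n. coface n m i w) + (\<Sum>i<n. coface (n - 1) m i (extra_degen (n - 1) m w))) xs
      = (if homog_list n m xs then w xs else 0)"
  proof (cases "homog_list n m xs")
    case True
    then have len: "length xs = Suc n" by (simp add: homog_list_def)
    obtain ys z where xs: "xs = ys @ [z]" "length ys = n" using True by (rule homog_list_snocE)
    have mn: "merge_at n (xs @ [(0, 1)]) = xs" by (simp add: xs merge_at_def nth_append)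
    have "extra_degen n m (\<Sum>i<Suc n. coface n m i w) xs
        = (-1) ^ n * (\<Sum>i<Suc n. (-1) ^ i * w (merge_at i (xs @ [(0, 1)])))"
      using True by (simp add: extra_degen_def sum_fun_apply coface_def homog_list_one del: sum.lessThan_Suc)
    also have "(\<Sum>i<Suc n. (-1) ^ i * w (merge_at i (xs @ [(0, 1)])))
        = (\<Sum>i<n. (-1) ^ i * w (merge_at i xs @ [(0, 1)])) + (-1) ^ n * w xs"
    proof -
      have "(\<Sum>i<n. (-1) ^ i * w (merge_at i (xs @ [(0, 1)])))
          = (\<Sum>i<n. (-1) ^ i * w (merge_at i xs @ [(0, 1)]))"
        by (intro sum.cong refl) (simp add: merge_at_snoc len)
      then show ?thesis by (simp add: mn)
    qed
    also have "(-1) ^ n * \<dots> = w xs + (\<Sum>i<n. (-1) ^ (n + i) * w (merge_at i xs @ [(0, 1)]))"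
      by (simp add: distrib_left sum_distrib_left power_add mult.assoc)
    finally have 1: "extra_degen n m (\<Sum>i<Suc n. coface n m i w) xs
        = w xs + (\<Sum>i<n. (-1) ^ (n + i) * w (merge_at i xs @ [(0, 1)]))" .
    have "coface (n - 1) m i (extra_degen (n - 1) m w) xs = - ((-1) ^ (n + i) * w (merge_at i xs @ [(0, 1)]))"
      if "i < n" for i
    proof -
      obtain k where n: "n = Suc k" using \<open>i < n\<close> by (cases n) auto
      show ?thesis using True homog_list_merge[of k m xs i] that
        by (simp add: n coface_def extra_degen_def power_add)
    qed
    then show ?thesis using True 1 by (simp add: sum_fun_apply sum_negf)
  qed (auto simp: extra_degen_def coface_def sum_fun_apply)
qed

text \<open>
  The sign of the last entry in \<open>cyc\<close> depends only on its own degree and on the total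
  degree, so the sign of a power multiplies the contributions of the entries moved so far.
\<close>

lemma cyc_power:
  assumes "length zs = k" "homog_list n m (ys @ zs)"
  shows "(cyc n m ^^ k) w (ys @ zs) = (-1) ^ (n * k + Suc m * sum_list (map fst zs)) * w (zs @ ys)"
  using assms
proof (induction k arbitrary: ys zs w)
  case 0
  then show ?case by simp
next
  case (Suc k)
  then obtain z zs' where zs: "zs = z # zs'" "length zs' = k" by (cases zs) auto
  have h: "homog_list n m ((zs' @ ys) @ [z])" using Suc.prems by (auto simp: zs homog_list_def)
  have "(cyc n m ^^ Suc k) w (ys @ zs) = (cyc n m ^^ k) (cyc n m w) ((ys @ [z]) @ zs')"
    by (simp add: zs funpow_swap1)
  also have "\<dots> = (-1) ^ (n * k + Suc m * sum_list (map fst zs')) * cyc n m w (zs' @ ys @ [z])"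
    using Suc.prems zs by (subst Suc.IH) auto
  also have "\<dots> = (-1) ^ (n * k + Suc m * sum_list (map fst zs')) * ((-1) ^ (n + Suc m * fst z) * w (zs @ ys))"
    using cyc_snoc[of n m w "zs' @ ys" z] h by (simp add: zs)
  finally show ?case by (simp add: zs power_add algebra_simps)
qed

text \<open>
  A full rotation has sign \<open>(-1)\<close> to the power \<open>n (n + 1) + (m + 1) m\<close>, which is even.
\<close>

lemma cyc_power_period:
  assumes "homog_list n m xs" shows "(cyc n m ^^ Suc n) w xs = w xs"
proof -
  have "(cyc n m ^^ Suc n) w xs = (-1) ^ (n * Suc n + Suc m * m) * w xs"
    using cyc_power[of xs "Suc n" n m "[]" w] assms by (simp add: homog_list_def)
  also have "(-1) ^ (n * Suc n + Suc m * m) = (1::'k)"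
    by (simp add: minus_one_power_iff)
  finally show ?thesis by simp
qed

definition supported :: "nat \<Rightarrow> nat \<Rightarrow> ((nat \<times> 'a) list \<Rightarrow> 'k) \<Rightarrow> bool" where
  "supported n m w \<longleftrightarrow> (\<forall>xs. \<not> homog_list n m xs \<longrightarrow> w xs = 0)"

text \<open>
  The sum telescopes to \<open>1 - \<tau>\<^sup>n\<^sup>+\<^sup>1 = 0\<close>.
\<close>

lemma norm_one_minus_cyc:
  assumes "supported n m w"
  shows "(\<Sum>i\<le>n. (cyc n m ^^ i) (w - cyc n m w)) = 0"
proof -
  have "(\<Sum>i\<le>n. (cyc n m ^^ i) (w - cyc n m w))
      = (\<Sum>i<Suc n. (cyc n m ^^ i) w - (cyc n m ^^ Suc i) w)"
    by (simp add: additive.diff[OF additive_cyc_power] funpow_swap1 flip: lessThan_Suc_atMost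
        del: sum.lessThan_Suc)
  also have "\<dots> = w - (cyc n m ^^ Suc n) w"
    using sum_lessThan_telescope'[of "\<lambda>i. (cyc n m ^^ i) w" "Suc n"] by simp
  also have "\<dots> = 0"
  proof
    fix xs
    show "(w - (cyc n m ^^ Suc n) w) xs = 0 xs"
      using assms cyc_power_period[of n m xs w]
      by (cases "homog_list n m xs") (simp_all add: supported_def cyc_def)
  qed
  finally show ?thesis .
qed

text \<open>
  All summands of \<open>b\<close> in one family, with the cyclic one at the end.
\<close>

definition signed_coface :: "nat \<Rightarrow> nat \<Rightarrow> nat \<Rightarrow> ((nat \<times> 'a) list \<Rightarrow> 'k) \<Rightarrow> (nat \<times> 'a) list \<Rightarrow> 'k" where
  "signed_coface n m i w = (if i \<le> n then coface n m i w else cyc (Suc n) m (coface n m 0 w))"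

lemma hochschild_as_sum: "hochschild n m w = (\<Sum>i\<le>Suc n. signed_coface n m i w)"
  by (simp add: hochschild_def signed_coface_def flip: lessThan_Suc_atMost)

lemma signed_coface_sum: "(\<Sum>i<Suc n. signed_coface n m i w) = (\<Sum>i<Suc n. coface n m i w)"
  by (rule sum.cong) (auto simp: signed_coface_def)

lemma signed_coface_relations:
  shows "i < Suc n \<Longrightarrow> cyc (Suc n) m (signed_coface n m (Suc i) w) = signed_coface n m i (cyc n m w)"
    and "signed_coface n m (Suc n) w = cyc (Suc n) m (signed_coface n m 0 w)"
  by (auto simp: signed_coface_def cyc_coface_Suc cyc_cyc_coface not_less_eq_eq less_Suc_eq)

lemma connes_hochschild:
  "connes n m (hochschild n m w)
    = (\<Sum>i\<le>n. (cyc n m ^^ i) (extra_degen n m (\<Sum>i<Suc n. coface n m i (w - cyc n m w))))"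
proof -
  have "hochschild n m w - cyc (Suc n) m (hochschild n m w)
      = (\<Sum>i<Suc n. coface n m i w) - (\<Sum>i<Suc n. coface n m i (cyc n m w))"
    using coface_sum_minus_cyclic[where n = "Suc n" and \<delta> = "signed_coface n m"
      and u = "cyc (Suc n) m" and t = "cyc n m", OF additive_cyc signed_coface_relations, of w]
    by (simp only: hochschild_as_sum signed_coface_sum)
  then show ?thesis
    by (simp add: connes_def additive.diff[OF additive_coface] del: sum.lessThan_Suc
        flip: sum_subtractf)
qed

lemma hochschild_connes:
  "hochschild n m (connes n m w)
    = (\<Sum>i\<le>Suc n. (cyc (Suc n) m ^^ i) (\<Sum>i<Suc n. coface n m i (extra_degen n m (w - cyc (Suc n) m w))))"
proof -
  let ?v = "extra_degen n m (w - cyc (Suc n) m w)"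
  have "hochschild n m (connes n m w) = (\<Sum>k<Suc n. hochschild n m ((cyc n m ^^ k) ?v))"
  proof -
    have "additive (hochschild n m)"
      by (simp add: additive_def hochschild_def additive.add[OF additive_cyc]
          additive.add[OF additive_coface] sum.distrib algebra_simps del: sum.lessThan_Suc)
    then show ?thesis
      by (simp add: connes_def additive.sum flip: lessThan_Suc_atMost del: sum.lessThan_Suc)
  qed
  also have "\<dots> = (\<Sum>i\<le>Suc n. (cyc (Suc n) m ^^ i) (\<Sum>i<Suc n. coface n m i ?v))"
    using coface_sum_norm[where n = "Suc n" and \<delta> = "signed_coface n m"
      and u = "cyc (Suc n) m" and t = "cyc n m", OF additive_cyc signed_coface_relations, of ?v]
    by (simp only: hochschild_as_sum signed_coface_sum)
  finally show ?thesis .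
qed

lemma supported_minus_cyc: "supported n m w \<Longrightarrow> supported n m (w - cyc n m w)"
  by (simp add: supported_def cyc_def)

lemma supported_restrict: "supported n m w \<Longrightarrow> (\<lambda>xs. if homog_list n m xs then w xs else 0) = w"
  by (auto simp: supported_def fun_eq_iff)

text \<open>
  The classical computation \<open>B b = N s (1 - \<tau>) b = N s b' (1 - \<tau>)\<close> and
  \<open>b B = b N s (1 - \<tau>) = N b' s (1 - \<tau>)\<close>. Since \<open>s b' + b' s = 1\<close>, their sum is
  \<open>N (1 - \<tau>) = 0\<close>. In the lowest degree the terms \<open>b B\<close> and \<open>b' s\<close> are absent.
\<close>

theorem hochschild_connes_anticommute:
  assumes w: "supported (Suc n) m w"
  shows "hochschild n m (connes n m w) + connes (Suc n) m (hochschild (Suc n) m w) = 0"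
proof -
  let ?v = "w - cyc (Suc n) m w"
  have "hochschild n m (connes n m w) + connes (Suc n) m (hochschild (Suc n) m w)
     = (\<Sum>i\<le>Suc n. (cyc (Suc n) m ^^ i) ((\<Sum>i<Suc n. coface n m i (extra_degen n m ?v))
          + extra_degen (Suc n) m (\<Sum>i<Suc (Suc n). coface (Suc n) m i ?v)))"
    unfolding hochschild_connes connes_hochschild
    by (simp only: additive.add[OF additive_cyc_power] sum.distrib)
  also have "(\<Sum>i<Suc n. coface n m i (extra_degen n m ?v))
      + extra_degen (Suc n) m (\<Sum>i<Suc (Suc n). coface (Suc n) m i ?v) = ?v"
    using extra_degen_homotopy[of "Suc n" m ?v] supported_restrict[OF supported_minus_cyc[OF w]]
    by (simp add: add.commute del: sum.lessThan_Suc)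
  also have "(\<Sum>i\<le>Suc n. (cyc (Suc n) m ^^ i) ?v) = 0" by (rule norm_one_minus_cyc[OF w])
  finally show ?thesis .
qed

theorem connes_hochschild_0:
  assumes w: "supported 0 m w"
  shows "connes 0 m (hochschild 0 m w) = 0"
proof -
  have "extra_degen 0 m (\<Sum>i<Suc 0. coface 0 m i (w - cyc 0 m w)) = w - cyc 0 m w"
    using extra_degen_homotopy[of 0 m "w - cyc 0 m w"] supported_restrict[OF supported_minus_cyc[OF w]]
    by simp
  then show ?thesis
    unfolding connes_hochschild using norm_one_minus_cyc[OF w] by simp
qed


subsection \<open>Compatibility with the internal differential\<close>

lemma lower_at_snoc:
  "i < length xs \<Longrightarrow> lower_at i w (xs @ [x]) = lower_at i (\<lambda>ys. w (ys @ [x])) xs"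
  by (simp add: lower_at_def nth_append list_update_append split: nat.split)

lemma lower_at_cong:
  assumes "homog_list n (Suc m) xs" "i < Suc n" "\<And>ys. homog_list n m ys \<Longrightarrow> w ys = w' ys"
  shows "lower_at i w xs = lower_at i w' xs"
  using homog_list_lower[OF assms(1,2)] assms(3) by (auto simp: lower_at_def split: nat.split)

lemma lower_at_scale: "lower_at i (\<lambda>ys. c * w ys) xs = c * lower_at i w xs"
  by (simp add: lower_at_def split: nat.split)

lemma extra_degen_codiff: "extra_degen n (Suc m) (codiff (Suc n) m w) = codiff n m (extra_degen n m w)"
proof
  fix xs
  show "extra_degen n (Suc m) (codiff (Suc n) m w) xs = codiff n m (extra_degen n m w) xs"
  proof (cases "homog_list n (Suc m) xs")
    case True
    then have len: "length xs = Suc n" by (simp add: homog_list_def)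
    let ?s = "\<lambda>i. (-1) ^ sum_list (map fst (take i xs)) :: 'k"
    let ?xs = "xs @ [(0, 1)]"
    have lower: "lower_at i (extra_degen n m w) xs = (-1) ^ n * lower_at i w ?xs" if "i < Suc n" for i
      using lower_at_cong[OF True that, of "extra_degen n m w" "\<lambda>ys. (-1) ^ n * w (ys @ [(0, 1)])"] that len
      by (simp add: extra_degen_def lower_at_snoc lower_at_scale)
    have unit: "lower_at (Suc n) w ?xs = 0"
      using len by (simp add: lower_at_def nth_append)
    have "codiff n m (extra_degen n m w) xs = (-1) ^ m * (\<Sum>i<Suc n. ?s i * lower_at i (extra_degen n m w) xs)"
      using True by (simp only: codiff_def if_True)
    also have "(\<Sum>i<Suc n. ?s i * lower_at i (extra_degen n m w) xs)
        = (-1) ^ n * (\<Sum>i<Suc n. (-1) ^ sum_list (map fst (take i ?xs)) * lower_at i w ?xs)"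
      unfolding sum_distrib_left by (rule sum.cong) (simp_all add: lower len mult.left_commute)
    also have "(\<Sum>i<Suc n. (-1) ^ sum_list (map fst (take i ?xs)) * lower_at i w ?xs)
        = (\<Sum>i<Suc (Suc n). (-1) ^ sum_list (map fst (take i ?xs)) * lower_at i w ?xs)"
      unfolding sum.lessThan_Suc[of _ "Suc n"] unit by simp
    also have "(-1) ^ m * ((-1) ^ n * \<dots>) = extra_degen n (Suc m) (codiff (Suc n) m w) xs"
      using True homog_list_one[of n "Suc m" xs] by (simp only: extra_degen_def codiff_def if_True mult.left_commute)
    finally show ?thesis by simp
  qed (simp add: extra_degen_def codiff_def)
qed

text \<open>
  On the left, the moved entry stands in front and contributes its degree to the signs of all other
  summands. On the right, it stays at the end, and the sign of the cyclic operator is the one for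
  total degree \<open>m\<close> instead of \<open>m + 1\<close>. Both differences amount to the degree of that entry.
\<close>

lemma cyc_codiff: "cyc n (Suc m) (codiff n m w) = codiff n m (cyc n m w)"
proof
  fix xs
  show "cyc n (Suc m) (codiff n m w) xs = codiff n m (cyc n m w) xs"
  proof (cases "homog_list n (Suc m) xs")
    case True
    then obtain ys z where xs: "xs = ys @ [z]" "length ys = n" by (rule homog_list_snocE)
    have h: "homog_list n (Suc m) (z # ys)" using True by (simp add: xs homog_list_rotate)
    let ?s = "\<lambda>i. (-1) ^ sum_list (map fst (take i ys)) :: 'k"
    let ?e = "(-1) ^ (n + Suc m * fst z) :: 'k"
    have total: "fst z + sum_list (map fst ys) = Suc m" using h by (simp add: homog_list_def)
    have 1: "lower_at i (cyc n m w) xs = ?e * lower_at (Suc i) w (z # ys)" if i: "i < n" for i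
    proof (cases "fst (ys ! i)")
      case 0
      then show ?thesis using i xs by (simp add: lower_at_def nth_append)
    next
      case (Suc d)
      have "homog_list n m (ys[i := (d, \<phi> (snd (ys ! i)))] @ [z])"
        using homog_list_lower[OF True, of i d] i xs Suc by (simp add: nth_append list_update_append)
      then show ?thesis
        using i xs Suc by (simp add: lower_at_def nth_append list_update_append cyc_snoc)
    qed
    have 2: "(-1) ^ sum_list (map fst ys) * lower_at n (cyc n m w) xs
        = (-1) ^ (n + Suc (Suc m) * fst z) * lower_at 0 w (z # ys)"
    proof (cases "fst z")
      case 0
      then show ?thesis using xs by (simp add: lower_at_def nth_append)
    next
      case (Suc d)
      have h': "homog_list n m (ys @ [(d, \<phi> (snd z))])"
        using homog_list_lower[OF True, of n d] xs Suc by (simp add: nth_append list_update_append)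
      have "even ((sum_list (map fst ys) + (n + Suc m * d)) + (n + Suc (Suc m) * fst z))"
        using total Suc by auto
      then have "(-1) ^ (sum_list (map fst ys) + (n + Suc m * d)) = ((-1) ^ (n + Suc (Suc m) * fst z) :: 'k)"
        by (rule minus_one_power_cong)
      then show ?thesis using xs Suc h'
        by (simp add: lower_at_def nth_append list_update_append cyc_snoc power_add mult.assoc)
    qed
    have "codiff n m (cyc n m w) xs = (-1) ^ m * ((\<Sum>i<n. ?s i * lower_at i (cyc n m w) xs)
        + (-1) ^ sum_list (map fst ys) * lower_at n (cyc n m w) xs)"
      using True xs by (simp add: codiff_def)
    also have "\<dots> = (-1) ^ m * ((\<Sum>i<n. ?s i * (?e * lower_at (Suc i) w (z # ys)))
        + (-1) ^ (n + Suc (Suc m) * fst z) * lower_at 0 w (z # ys))"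
      using 1 2 by simp
    also have "\<dots> = (-1) ^ (n + Suc (Suc m) * fst z) * ((-1) ^ m * (lower_at 0 w (z # ys)
        + (\<Sum>i<n. (-1) ^ (fst z + sum_list (map fst (take i ys))) * lower_at (Suc i) w (z # ys))))"
    proof -
      have "(-1) ^ (n + Suc (Suc m) * fst z) * (-1) ^ (fst z + a) = (-1) ^ a * ?e" for a
        unfolding power_add[symmetric] by (rule minus_one_power_cong) auto
      then have "?s i * (?e * x) = (-1) ^ (n + Suc (Suc m) * fst z) *
          ((-1) ^ (fst z + sum_list (map fst (take i ys))) * x)" for i x
        by (simp add: mult.assoc[symmetric])
      then show ?thesis by (simp only: distrib_left sum_distrib_left mult.left_commute[of "(-1) ^ m"] add.commute)
    qed
    also have "\<dots> = cyc n (Suc m) (codiff n m w) xs"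
      using True h xs by (simp add: xs(1) cyc_snoc codiff_def sum.lessThan_Suc_shift del: sum.lessThan_Suc)
    finally show ?thesis by simp
  qed (simp add: cyc_def codiff_def)
qed

theorem connes_codiff: "connes n (Suc m) (codiff (Suc n) m w) = codiff n m (connes n m w)"
proof -
  have "(cyc n (Suc m) ^^ i) (codiff n m v) = codiff n m ((cyc n m ^^ i) v)" for i v
    by (induction i) (simp_all add: cyc_codiff)
  then show ?thesis
    by (simp add: connes_def cyc_codiff extra_degen_codiff additive.sum[OF additive_codiff]
        flip: additive.diff[OF additive_codiff])
qed


subsection \<open>Transfer to cochains\<close>

text \<open>
  Taking values identifies each operator on cochains with its formula on functions of homogeneous
  lists. As the values determine the cochain, all identities transfer.
\<close>

definition val :: "nat \<Rightarrow> nat \<Rightarrow> ('k, 'a) cochain \<Rightarrow> (nat \<times> 'a) list \<Rightarrow> 'k" where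
  "val n m f xs = (if homog_list n m xs then f (elem_tensor (map snd xs)) else 0)"

lemma homog_list_iff:
  "homog_list n m xs \<longleftrightarrow> length (map snd xs) = Suc n \<and> homog (map fst xs) (map snd xs) \<and> sum_list (map fst xs) = m"
  by (auto simp: homog_list_def homog_def list.rel_map list_all2_same)

lemma homog_zip:
  assumes "length as = Suc n" "homog ds as" "sum_list ds = m"
  shows "homog_list n m (zip ds as)" "map fst (zip ds as) = ds" "map snd (zip ds as) = as"
  using assms homog_length[OF assms(2)] by (simp_all add: homog_list_iff)

lemma val_inject:
  assumes "f \<in> C n m" "g \<in> C n m" "val n m f = val n m g"
  shows "f = g"
proof (rule C_eqI[OF assms(1,2)])
  fix ds as assume "length as = Suc n" "homog ds as" "sum_list ds = m"
  from homog_zip[OF this] show "f (elem_tensor as) = g (elem_tensor as)"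
    using fun_cong[OF assms(3), of "zip ds as"] by (simp add: val_def)
qed

lemma supported_val: "supported n m (val n m f)"
  by (simp add: supported_def val_def)

lemma val_linear:
  shows val_add: "val n m (f + g) = val n m f + val n m g"
    and val_diff: "val n m (f - g) = val n m f - val n m g"
    and val_scale: "val n m (\<lambda>X. c * f X) = (\<lambda>xs. c * val n m f xs)"
    and val_zero: "val n m 0 = 0"
  by (auto simp: val_def fun_eq_iff)

lemma val_sum: "val n m (\<Sum>i\<in>I. f i) = (\<Sum>i\<in>I. val n m (f i))"
  by (simp add: val_def fun_eq_iff sum_fun_apply)

lemma C_sum_closed: "(\<And>i. i \<in> I \<Longrightarrow> f i \<in> C n m) \<Longrightarrow> (\<Sum>i\<in>I. f i) \<in> C n m"
  by (induction I rule: infinite_finite_induct) (simp_all add: C_zero C_plus)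

lemma val_cochain_of:
  assumes "graded_multilinear (Suc n) m v"
  shows "val n m (cochain_of n m v) = (\<lambda>xs. if homog_list n m xs then v (map fst xs) (map snd xs) else 0)"
  using cochain_of_elem[OF assms] by (auto simp: val_def fun_eq_iff homog_list_iff)

lemma graded_multilinear_lists:
  assumes f: "f \<in> C n' m'" and \<sigma>: "slotwise (Suc n) (Suc n') \<sigma>"
    and hom: "\<And>xs. homog_list n m xs \<Longrightarrow> \<exists>ys. homog_list n' m' ys \<and> map snd ys = \<sigma> (map snd xs)"
  shows "graded_multilinear (Suc n) m (\<lambda>ds as. c ds * f (elem_tensor (\<sigma> as)))"
proof (rule graded_multilinear_slotwise[OF f \<sigma>])
  fix ds as assume "length as = Suc n" "homog ds as" "sum_list ds = m"
  from hom[OF homog_zip(1)[OF this]] homog_zip(3)[OF this]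
  show "\<exists>ds'. homog ds' (\<sigma> as) \<and> sum_list ds' = m'" by (metis homog_list_iff)
qed

lemma slotwise_cong:
  assumes "slotwise n n' \<sigma>" "\<And>as. length as = n \<Longrightarrow> \<rho> as = \<sigma> as"
  shows "slotwise n n' \<rho>"
  using assms by (simp add: slotwise_def)

lemma slotwise_rotate: "slotwise (Suc n) (Suc n) (\<lambda>as. last as # butlast as)"
proof (rule slotwiseI)
  fix as :: "'a list" and j assume as: "length as = Suc n" and j: "j < Suc n"
  define j' where "j' = (if j = n then 0 else Suc j)"
  obtain bs a where "as = bs @ [a]" "length bs = n" using as by (cases as rule: rev_cases) auto
  then have "last (as[j := x]) # butlast (as[j := x]) = (last as # butlast as)[j' := id x]" for x
    using j by (simp add: j'_def list_update_append)
  then show "\<exists>j'<Suc n. \<exists>h. (\<forall>x y. h (x + y) = h x + h y) \<and> (\<forall>c x. h (scale c x) = scale c (h x)) \<and>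
      (\<forall>x. last (as[j := x]) # butlast (as[j := x]) = (last as # butlast as)[j' := h x])"
    using j by (intro exI[of _ j'] conjI exI[of _ id]) (auto simp: j'_def)
qed auto

lemma slotwise_one: "slotwise (Suc n) (Suc (Suc n)) (\<lambda>as. as @ [1])"
proof (rule slotwiseI)
  fix as :: "'a list" and j assume "length as = Suc n" and "j < Suc n"
  then show "\<exists>j'<Suc (Suc n). \<exists>h. (\<forall>x y. h (x + y) = h x + h y) \<and>
      (\<forall>c x. h (scale c x) = scale c (h x)) \<and> (\<forall>x. as[j := x] @ [1] = (as @ [1])[j' := h x])"
    by (intro exI[of _ j] conjI exI[of _ id]) (auto simp: list_update_append)
qed auto

text \<open>
  Entries to the right of the product move one position to the left, and the two factors share the
  position of the product, on which each acts linearly by multiplication with the other.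
\<close>

lemma slotwise_merge:
  assumes i: "i < Suc n"
  shows "slotwise (Suc (Suc n)) (Suc n) (\<lambda>as. take i as @ (as ! i * as ! (i + 1)) # drop (i + 2) as)"
proof (rule slotwiseI)
  fix as :: "'a list" and j assume as: "length as = Suc (Suc n)" and j: "j < Suc (Suc n)"
  define j' where "j' = (if j \<le> i then j else j - 1)"
  define h where "h x = (if j = i then x * as ! Suc i else if j = Suc i then as ! i * x else x)" for x
  have "take i (as[j := x]) @ (as[j := x] ! i * as[j := x] ! (i + 1)) # drop (i + 2) (as[j := x])
      = (take i as @ (as ! i * as ! (i + 1)) # drop (i + 2) as)[j' := h x]" for x
    using as i j
    by (intro nth_equalityI)
      (auto simp: j'_def h_def nth_append nth_list_update nth_Cons' min_def)
  then show "\<exists>j'<Suc n. \<exists>h. (\<forall>x y. h (x + y) = h x + h y) \<and> (\<forall>c x. h (scale c x) = scale c (h x)) \<and>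
      (\<forall>x. take i (as[j := x]) @ (as[j := x] ! i * as[j := x] ! (i + 1)) # drop (i + 2) (as[j := x])
      = (take i as @ (as ! i * as ! (i + 1)) # drop (i + 2) as)[j' := h x])"
    using i j by (intro exI[of _ j'] conjI exI[of _ h])
      (auto simp: j'_def h_def distrib_left distrib_right scale_mult_left scale_mult_right)
qed (use i in auto)

lemma map_snd_merge_at:
  "Suc i < length xs \<Longrightarrow> map snd (merge_at i xs)
    = take i (map snd xs) @ (map snd xs ! i * map snd xs ! (i + 1)) # drop (i + 2) (map snd xs)"
  by (simp add: merge_at_def take_map drop_map)

lemma gam_sign:
  assumes "homog_list n m xs"
  shows "(-1) ^ (n + gam n (map fst xs)) = ((-1) ^ (n + Suc m * fst (last xs)) :: 'k)"
proof -
  obtain ys x where xs: "xs = ys @ [x]" "length ys = n" using assms by (rule homog_list_snocE)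
  have "m = sum_list (map fst ys) + fst x" using assms by (simp add: homog_list_def xs)
  then show ?thesis
    by (intro minus_one_power_cong) (auto simp: gam_def xs nth_append)
qed

lemma op_tau:
  assumes f: "f \<in> C n m"
  shows op_tau_in_C: "op_tau n m f \<in> C n m" and val_op_tau: "val n m (op_tau n m f) = cyc n m (val n m f)"
proof -
  have gm: "graded_multilinear (Suc n) m (\<lambda>ds as. (-1) ^ (n + gam n ds) * f (elem_tensor (last as # butlast as)))"
  proof (rule graded_multilinear_lists[OF f slotwise_rotate])
    fix xs assume xs: "homog_list n m xs"
    then have "xs \<noteq> []" by (auto simp: homog_list_def)
    then show "\<exists>ys. homog_list n m ys \<and> map snd ys = last (map snd xs) # butlast (map snd xs)"
      using homog_list_cyc[OF xs] by (intro exI[of _ "last xs # butlast xs"]) (simp add: last_map map_butlast)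
  qed
  show "op_tau n m f \<in> C n m" unfolding op_tau_def by (rule cochain_of_in_C[OF gm])
  show "val n m (op_tau n m f) = cyc n m (val n m f)"
  proof
    fix xs
    show "val n m (op_tau n m f) xs = cyc n m (val n m f) xs"
    proof (cases "homog_list n m xs")
      case True
      then have "xs \<noteq> []" by (auto simp: homog_list_def)
      then show ?thesis using True gam_sign[OF True] homog_list_cyc[OF True]
        by (simp add: op_tau_def val_cochain_of[OF gm] cyc_def val_def[of n m f] last_map map_butlast)
    qed (simp add: val_def cyc_def)
  qed
qed

lemma op_s:
  assumes f: "f \<in> C (Suc n) m"
  shows op_s_in_C: "op_s n m f \<in> C n m" and val_op_s: "val n m (op_s n m f) = extra_degen n m (val (Suc n) m f)"
proof -
  have gm: "graded_multilinear (Suc n) m (\<lambda>ds as. (-1) ^ n * f (elem_tensor (as @ [1])))"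
  proof (rule graded_multilinear_lists[OF f slotwise_one])
    fix xs assume xs: "homog_list n m xs"
    then show "\<exists>ys. homog_list (Suc n) m ys \<and> map snd ys = map snd xs @ [1]"
      by (intro exI[of _ "xs @ [(0, 1)]"]) (simp add: homog_list_one)
  qed
  show "op_s n m f \<in> C n m" unfolding op_s_def by (rule cochain_of_in_C[OF gm])
  show "val n m (op_s n m f) = extra_degen n m (val (Suc n) m f)"
    by (auto simp: fun_eq_iff op_s_def val_cochain_of[OF gm] extra_degen_def val_def[of "Suc n" m f] homog_list_one)
qed

lemma op_b:
  assumes f: "f \<in> C n m"
  shows op_b_in_C: "op_b (Suc n) m f \<in> C (Suc n) m"
    and val_op_b: "val (Suc n) m (op_b (Suc n) m f) = hochschild n m (val n m f)"
proof -
  let ?\<sigma> = "\<lambda>i as. take i as @ (as ! i * as ! (i + 1)) # drop (i + 2) (as :: 'a list)"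
  let ?\<rho> = "\<lambda>as. (as ! Suc n * as ! 0) # butlast (tl as :: 'a list)"
  have \<rho>: "?\<rho> as = ?\<sigma> 0 (last as # butlast as)" if len: "length as = Suc (Suc n)" for as :: "'a list"
  proof -
    obtain a us where as: "as = a # us" "length us = Suc n" using len by (auto simp: length_Suc_conv)
    moreover obtain vs z where "us = vs @ [z]" "length vs = n"
      using as by (cases us rule: rev_cases) auto
    ultimately show ?thesis by (simp add: nth_append butlast_append)
  qed
  have mg: "\<exists>ys. homog_list n m ys \<and> map snd ys = ?\<sigma> i (map snd xs)"
    if "homog_list (Suc n) m xs" "i < Suc n" for i xs
    using homog_list_merge[OF that] that map_snd_merge_at[of i xs]
    by (intro exI[of _ "merge_at i xs"]) (simp add: homog_list_def)
  have snd_rot: "map snd (last xs # butlast xs) = last (map snd xs) # butlast (map snd xs)"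
    if "homog_list (Suc n) m xs" for xs :: "(nat \<times> 'a) list"
    using that by (cases "xs = []") (auto simp: homog_list_def last_map map_butlast)
  have "slotwise (Suc (Suc n)) (Suc n) ?\<rho>"
    by (rule slotwise_cong[OF slotwise_compose[OF slotwise_rotate slotwise_merge[of 0]] \<rho>]) auto
  moreover have "\<exists>ys. homog_list n m ys \<and> map snd ys = ?\<rho> (map snd xs)" if "homog_list (Suc n) m xs" for xs
    using mg[OF homog_list_cyc[OF that], of 0] \<rho>[of "map snd xs"] that
    unfolding snd_rot[OF that] by (simp add: homog_list_def)
  ultimately have gm: "graded_multilinear (Suc (Suc n)) m (\<lambda>ds as.
      (\<Sum>i<Suc n. (-1) ^ i * f (elem_tensor (?\<sigma> i as))) + (-1) ^ (Suc n + gam (Suc n) ds) * f (elem_tensor (?\<rho> as)))"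
    using mg by (intro graded_multilinear_add graded_multilinear_sum
        graded_multilinear_lists[OF f, where c = "\<lambda>_. (-1) ^ i" for i]
        graded_multilinear_lists[OF f, where c = "\<lambda>ds. (-1) ^ (Suc n + gam (Suc n) ds)"]
        slotwise_merge) auto
  show "op_b (Suc n) m f \<in> C (Suc n) m" unfolding op_b_def by (rule cochain_of_in_C[OF gm])
  show "val (Suc n) m (op_b (Suc n) m f) = hochschild n m (val n m f)"
  proof
    fix xs
    show "val (Suc n) m (op_b (Suc n) m f) xs = hochschild n m (val n m f) xs"
    proof (cases "homog_list (Suc n) m xs")
      case True
      note rot = homog_list_cyc[OF True]
      have face: "coface n m i (val n m f) ys = (-1) ^ i * f (elem_tensor (?\<sigma> i (map snd ys)))"
        if "homog_list (Suc n) m ys" "i < Suc n" for i ys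
        using homog_list_merge[OF that] map_snd_merge_at[of i ys] that
        by (simp add: coface_def val_def homog_list_def)
      have len: "length (map snd xs) = Suc (Suc n)" using True by (simp add: homog_list_def)
      have "coface n m 0 (val n m f) (last xs # butlast xs) = f (elem_tensor (?\<rho> (map snd xs)))"
        unfolding face[OF rot zero_less_Suc] snd_rot[OF True] \<rho>[OF len] by simp
      then have "cyc (Suc n) m (coface n m 0 (val n m f)) xs
          = (-1) ^ (Suc n + gam (Suc n) (map fst xs)) * f (elem_tensor (?\<rho> (map snd xs)))"
        using True gam_sign[OF True] by (simp add: cyc_def)
      then show ?thesis
        using True face[OF True]
        unfolding op_b_def val_cochain_of[OF gm] hochschild_def
        by (simp add: sum_fun_apply del: sum.lessThan_Suc)
    qed (simp add: val_def hochschild_def cyc_def coface_def sum_fun_apply)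
  qed
qed

lemma op_delta:
  assumes f: "f \<in> C n m"
  shows op_delta_in_C: "op_delta n m f \<in> C n (Suc m)"
    and val_op_delta: "val n (Suc m) (op_delta n m f) = codiff n m (val n m f)"
proof -
  let ?R = "tensor_rel (Suc n)"
  have eq: "op_delta n m f (x +o ?R) = (-1) ^ m * f (diff_rep (Suc n) x +o ?R)"
    if "x \<in> deg_reps (Suc n) (Suc m)" for x
    using that tensor_diff_coset[OF subsetD[OF deg_reps_subset_pow_reps that]]
    by (simp add: op_delta_def representatives_def)
  show "op_delta n m f \<in> C n (Suc m)"
    unfolding C_def Suc_eq_plus1[symmetric]
  proof (intro CollectI conjI ballI allI impI)
    fix X Y c assume X: "X \<in> tensor_pow_deg (Suc n) (Suc m)"
    then obtain x where x: "X = x +o ?R" "x \<in> deg_reps (Suc n) (Suc m)"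
      unfolding tensor_pow_deg_def by (rule quot_obtain_representative)
    show "op_delta n m f (quot_scale free_scale ?R c X) = c * op_delta n m f X"
      using x free.subspace_scale[OF subspace_deg_reps x(2)] C_scale[OF f diff_rep_deg_reps[OF x(2)]]
      by (simp add: quot_scale_tensor_coset eq diff_rep_def diff_rep_linear)
    assume Y: "Y \<in> tensor_pow_deg (Suc n) (Suc m)"
    then obtain y where y: "Y = y +o ?R" "y \<in> deg_reps (Suc n) (Suc m)"
      unfolding tensor_pow_deg_def by (rule quot_obtain_representative)
    show "op_delta n m f (X + Y) = op_delta n m f X + op_delta n m f Y"
      using x y free.subspace_add[OF subspace_deg_reps x(2) y(2)]
        C_add[OF f diff_rep_deg_reps[OF x(2)] diff_rep_deg_reps[OF y(2)]]
      by (simp add: coset_plus[OF tensor_rel_subgroup] eq diff_rep_def diff_rep_linear distrib_left)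
  qed (simp add: op_delta_def)
  show "val n (Suc m) (op_delta n m f) = codiff n m (val n m f)"
  proof
    fix xs
    show "val n (Suc m) (op_delta n m f) xs = codiff n m (val n m f) xs"
    proof (cases "homog_list n (Suc m) xs")
      case True
      define as where "as = map snd xs"
      define ds where "ds = map fst xs"
      have h: "length as = Suc n" "homog ds as" "sum_list ds = Suc m"
        using True by (simp_all add: homog_list_iff as_def ds_def)
      have len: "length xs = Suc n" using True by (simp add: homog_list_def)
      let ?x = "\<lambda>i. Poly_Mapping.single (as[i := \<phi> (as ! i)]) ((-1) ^ sum_list (take i ds))"
      have "op_delta n m f (elem_tensor as) = (-1) ^ m * f ((\<Sum>i<Suc n. ?x i) +o ?R)"
        using eq[OF single_in_deg_reps[OF h, of 1]] diff_rep_homogeneous[OF h(1,2)] h(1)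
        by (simp add: elem_tensor_def coset_eq_iff[OF tensor_rel_subgroup, symmetric] del: sum.lessThan_Suc)
      also have "f ((\<Sum>i<Suc n. ?x i) +o ?R) = (\<Sum>i<Suc n. f (?x i +o ?R))"
        using \<phi>_entry_in_deg_reps[OF h(1,2)] h(3) by (intro C_sum[OF f]) auto
      also have "\<dots> = (\<Sum>i<Suc n. (-1) ^ sum_list (map fst (take i xs)) * lower_at i (val n m f) xs)"
      proof (rule sum.cong[OF refl])
        fix i assume "i \<in> {..<Suc n}"
        then have i: "i < Suc n" by simp
        show "f (?x i +o ?R) = (-1) ^ sum_list (map fst (take i xs)) * lower_at i (val n m f) xs"
        proof (cases "ds ! i")
          case 0
          then have "\<phi> (as ! i) = 0" using h i \<phi>_A_0[of "as ! i"] by (auto simp: homog_iff_nth)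
          then have "?x i \<in> ?R"
            using h i by (intro single_zero_in_tensor_rel[of _ _ i]) auto
          then show ?thesis using C_tensor_rel[OF f, of "?x i"] 0 i len
            by (simp add: lower_at_def ds_def)
        next
          case (Suc d)
          have "homog_list n m (xs[i := (d, \<phi> (snd (xs ! i)))])"
            using homog_list_lower[OF True i, of d] Suc i len by (simp add: ds_def)
          moreover have "f (?x i +o ?R) = (-1) ^ sum_list (take i ds) * f (elem_tensor (as[i := \<phi> (as ! i)]))"
            using homog_\<phi>[OF h(2) _ Suc] h i by (intro C_single[OF f]) auto
          ultimately show ?thesis using Suc i len
            by (simp add: lower_at_def ds_def as_def val_def map_update take_map)
        qed
      qed
      finally show ?thesis using True by (simp add: val_def[of n "Suc m"] codiff_def as_def)
    qed (simp add: val_def codiff_def)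
  qed
qed

lemma op_tau_power:
  assumes "f \<in> C n m"
  shows "(op_tau n m ^^ i) f \<in> C n m \<and> val n m ((op_tau n m ^^ i) f) = (cyc n m ^^ i) (val n m f)"
  using assms by (induction i) (simp_all add: op_tau)

lemma op_B:
  assumes f: "f \<in> C (Suc n) m"
  shows op_B_in_C: "op_B n m f \<in> C n m" and val_op_B: "val n m (op_B n m f) = connes n m (val (Suc n) m f)"
proof -
  let ?g = "f - op_tau (Suc n) m f"
  have g: "?g \<in> C (Suc n) m" by (rule C_minus[OF f op_tau_in_C[OF f]])
  note pow = op_tau_power[OF op_s_in_C[OF g]]
  show "op_B n m f \<in> C n m"
    using pow by (simp add: op_B_def op_N_def C_sum_closed)
  show "val n m (op_B n m f) = connes n m (val (Suc n) m f)"
    using pow by (simp add: op_B_def op_N_def val_sum connes_def val_op_s[OF g] val_diff val_op_tau[OF f])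
qed

theorem op_b_op_B_anticommute:
  assumes f: "f \<in> C (Suc n) m"
  shows "op_b (Suc n) m (op_B n m f) + op_B (Suc n) m (op_b (Suc (Suc n)) m f) = 0"
proof (rule val_inject)
  show "op_b (Suc n) m (op_B n m f) + op_B (Suc n) m (op_b (Suc (Suc n)) m f) \<in> C (Suc n) m"
    by (intro C_plus op_b_in_C op_B_in_C f)
  show "val (Suc n) m (op_b (Suc n) m (op_B n m f) + op_B (Suc n) m (op_b (Suc (Suc n)) m f))
      = val (Suc n) m 0"
    by (simp add: val_add val_zero val_op_b val_op_B op_b_in_C op_B_in_C f
        hochschild_connes_anticommute supported_val)
qed (rule C_zero)

theorem op_B_op_b_0:
  assumes f: "f \<in> C 0 m"
  shows "op_B 0 m (op_b (Suc 0) m f) = 0"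
  by (rule val_inject[of _ 0 m])
    (simp_all add: op_B_in_C op_b_in_C f C_zero val_op_B val_op_b val_zero connes_hochschild_0 supported_val)

theorem op_B_op_delta:
  assumes f: "f \<in> C (Suc n) m"
  shows "op_B n (Suc m) (op_delta (Suc n) m f) = op_delta n m (op_B n m f)"
  by (rule val_inject[of _ n "Suc m"])
    (simp_all add: op_B_in_C op_delta_in_C f val_op_B val_op_delta connes_codiff)


section \<open>The total complexes\<close>

subsection \<open>Linearity of the operators\<close>

text \<open>
  Additivity and homogeneity in one condition, in the form in which it carries over to the cochains,
  where scalar multiplication is written pointwise.
\<close>

definition scale_linear :: "(('x \<Rightarrow> 'k) \<Rightarrow> 'y \<Rightarrow> 'k) \<Rightarrow> bool" where
  "scale_linear F \<longleftrightarrow> (\<forall>c v w. F (v + (\<lambda>x. c * w x)) = F v + (\<lambda>y. c * F w y))"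

lemma scale_linear_operators:
  shows "scale_linear (cyc n m)" "scale_linear (coface n m i)" "scale_linear (extra_degen n m)"
proof -
  show "scale_linear (cyc n m)" "scale_linear (coface n m i)" "scale_linear (extra_degen n m)"
    by (auto simp: scale_linear_def fun_eq_iff cyc_def coface_def extra_degen_def algebra_simps)
qed

lemma scale_linear_codiff: "scale_linear (codiff n m)"
proof -
  have "lower_at i (v + (\<lambda>x. c * w x)) xs = lower_at i v xs + c * lower_at i w xs" for i v c w xs
    by (simp add: lower_at_def split: nat.split)
  then show ?thesis
    by (simp add: scale_linear_def fun_eq_iff codiff_def distrib_left sum.distrib sum_distrib_left
        mult.left_commute del: sum.lessThan_Suc)
qed

lemma scale_linear_compose:
  "scale_linear F \<Longrightarrow> scale_linear G \<Longrightarrow> scale_linear (\<lambda>w. F (G w))"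
  by (simp add: scale_linear_def)

lemma scale_linear_add:
  "scale_linear F \<Longrightarrow> scale_linear G \<Longrightarrow> scale_linear (\<lambda>w. F w + G w)"
  by (auto simp: scale_linear_def fun_eq_iff algebra_simps)

lemma scale_linear_diff:
  "scale_linear F \<Longrightarrow> scale_linear G \<Longrightarrow> scale_linear (\<lambda>w. F w - G w)"
  by (auto simp: scale_linear_def fun_eq_iff algebra_simps)

lemma scale_linear_sum:
  assumes "\<And>i. i \<in> I \<Longrightarrow> scale_linear (F i)" shows "scale_linear (\<lambda>w. \<Sum>i\<in>I. F i w)"
  using assms
  by (auto simp: scale_linear_def fun_eq_iff sum_fun_apply sum_distrib_left sum.distrib
      intro!: sum.cong simp flip: sum.distrib)

lemma scale_linear_power:
  fixes F :: "('x \<Rightarrow> 'k) \<Rightarrow> 'x \<Rightarrow> 'k"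
  assumes "scale_linear F" shows "scale_linear (F ^^ i)"
  by (induction i) (use assms in \<open>simp_all add: scale_linear_def\<close>)

lemma scale_linear_hochschild: "scale_linear (hochschild n m)"
  unfolding hochschild_def[abs_def]
  by (intro scale_linear_add scale_linear_sum scale_linear_operators
      scale_linear_compose[OF scale_linear_operators(1,2)])

lemma scale_linear_connes: "scale_linear (connes n m)"
proof -
  have "scale_linear (\<lambda>w. w - cyc (Suc n) m w)"
    by (rule scale_linear_diff[OF _ scale_linear_operators(1)]) (simp add: scale_linear_def)
  then show ?thesis
    unfolding connes_def[abs_def]
    by (intro scale_linear_sum scale_linear_compose[OF scale_linear_power[OF scale_linear_operators(1)]]
        scale_linear_compose[OF scale_linear_operators(3)])
qed

lemma C_lincomb: "f \<in> C n m \<Longrightarrow> g \<in> C n m \<Longrightarrow> f + (\<lambda>X. c * g X) \<in> C n m"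
  by (rule C_plus[OF _ C_scaled])

lemma val_lincomb: "val n m (f + (\<lambda>X. c * g X)) = val n m f + (\<lambda>xs. c * val n m g xs)"
  by (simp add: val_add val_scale)

lemma scale_linear_transfer:
  assumes F: "scale_linear F"
    and op: "\<And>h. h \<in> C n m \<Longrightarrow> op h \<in> C n' m' \<and> val n' m' (op h) = F (val n m h)"
    and "f \<in> C n m" "g \<in> C n m"
  shows "op (f + (\<lambda>X. c * g X)) = op f + (\<lambda>X. c * op g X)"
  using assms C_lincomb[OF assms(3,4)]
  by (intro val_inject[of _ n' m']) (simp_all add: val_lincomb C_lincomb scale_linear_def)

lemma op_b_lincomb:
  assumes "f \<in> C n m" "g \<in> C n m"
  shows "op_b (Suc n) m (f + (\<lambda>X. c * g X)) = op_b (Suc n) m f + (\<lambda>X. c * op_b (Suc n) m g X)"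
  by (rule scale_linear_transfer[OF scale_linear_hochschild conjI[OF op_b_in_C val_op_b] assms])

lemma op_delta_lincomb:
  assumes "f \<in> C n m" "g \<in> C n m"
  shows "op_delta n m (f + (\<lambda>X. c * g X)) = op_delta n m f + (\<lambda>X. c * op_delta n m g X)"
  by (rule scale_linear_transfer[OF scale_linear_codiff conjI[OF op_delta_in_C val_op_delta] assms])

lemma op_B_lincomb:
  assumes "f \<in> C (Suc n) m" "g \<in> C (Suc n) m"
  shows "op_B n m (f + (\<lambda>X. c * g X)) = op_B n m f + (\<lambda>X. c * op_B n m g X)"
  by (rule scale_linear_transfer[OF scale_linear_connes conjI[OF op_B_in_C val_op_B] assms])

lemma operators_zero:
  shows op_b_zero: "op_b (Suc n) m 0 = 0" and op_delta_zero: "op_delta n m 0 = 0"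
    and op_B_zero: "op_B n m 0 = 0"
proof -
  have z: "0 + (\<lambda>X. -1 * 0 X) = (0 :: ('k, 'a) cochain)" by (simp add: fun_eq_iff)
  show "op_b (Suc n) m 0 = 0" "op_delta n m 0 = 0" "op_B n m 0 = 0"
    using op_b_lincomb[OF C_zero C_zero, of n m "-1"] op_delta_lincomb[OF C_zero C_zero, of n m "-1"]
      op_B_lincomb[OF C_zero C_zero, of n m "-1"]
    unfolding z by (simp_all add: fun_eq_iff)
qed


subsection \<open>The Hochschild complex\<close>

lemma T_EHD: "f \<in> T_EH n \<Longrightarrow> f p q \<in> C p q" and T_EH_zero: "f \<in> T_EH n \<Longrightarrow> int (p + q) \<noteq> n \<Longrightarrow> f p q = 0"
  by (simp_all add: T_EH_def)

lemma zero_in_T_EH: "0 \<in> T_EH n"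
  by (simp add: T_EH_def C_zero)

lemma EH_scale_apply: "EH_scale c f p q = (\<lambda>X. c * f p q X)"
  by (simp add: EH_scale_def)

lemma T_EH_lincomb: "f \<in> T_EH n \<Longrightarrow> g \<in> T_EH n \<Longrightarrow> f + EH_scale c g \<in> T_EH n"
  by (auto simp: T_EH_def EH_scale_apply fun_eq_iff intro: C_lincomb)

lemma d_EH_in_T_EH:
  assumes f: "f \<in> T_EH n" shows "d_EH f \<in> T_EH (n + 1)"
  unfolding T_EH_def
proof (intro CollectI allI conjI impI)
  fix p q
  have b: "(if 0 < p then op_b p q (f (p - 1) q) else 0) \<in> C p q"
    using op_b_in_C[OF T_EHD[OF f], of "p - 1" q] by (auto simp: C_zero)
  have "(if 0 < q then (\<lambda>X. (-1) ^ p * op_delta p (q - 1) (f p (q - 1)) X) else 0) \<in> C p q"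
    using C_scaled[OF op_delta_in_C[OF T_EHD[OF f, of p "q - 1"]]] by (auto simp: C_zero)
  then show "d_EH f p q \<in> C p q" unfolding d_EH_def by (rule C_plus[OF b])
  assume "int (p + q) \<noteq> n + 1"
  then have "0 < p \<Longrightarrow> f (p - 1) q = 0" "0 < q \<Longrightarrow> f p (q - 1) = 0"
    by (auto intro!: T_EH_zero[OF f])
  then have "d_EH f p q X = 0" for X
    using op_b_zero[of "p - 1" q] by (auto simp: d_EH_def op_delta_zero)
  then show "d_EH f p q = 0" by (simp add: fun_eq_iff)
qed

lemma d_EH_lincomb:
  assumes f: "f \<in> T_EH n" and g: "g \<in> T_EH n"
  shows "d_EH (f + EH_scale c g) = d_EH f + EH_scale c (d_EH g)"
proof (intro ext)
  fix p q X
  have "0 < p \<Longrightarrow> op_b p q (f (p - 1) q + (\<lambda>X. c * g (p - 1) q X))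
      = op_b p q (f (p - 1) q) + (\<lambda>X. c * op_b p q (g (p - 1) q) X)"
    using op_b_lincomb[OF T_EHD[OF f, of "p - 1" q] T_EHD[OF g, of "p - 1" q]] by simp
  moreover have "op_delta p (q - 1) (f p (q - 1) + (\<lambda>X. c * g p (q - 1) X))
      = op_delta p (q - 1) (f p (q - 1)) + (\<lambda>X. c * op_delta p (q - 1) (g p (q - 1)) X)" for p
    by (rule op_delta_lincomb[OF T_EHD[OF f] T_EHD[OF g]])
  ultimately show "d_EH (f + EH_scale c g) p q X = (d_EH f + EH_scale c (d_EH g)) p q X"
    by (simp add: d_EH_def EH_scale_apply algebra_simps)
qed

lemma B_EH_in_T_EH:
  assumes f: "f \<in> T_EH n" shows "B_EH f \<in> T_EH (n - 1)"
  unfolding T_EH_def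
proof (intro CollectI allI conjI impI)
  fix p q
  show "B_EH f p q \<in> C p q"
    using op_B_in_C[OF T_EHD[OF f], of p q] by (simp add: B_EH_def)
  assume "int (p + q) \<noteq> n - 1"
  then have "f (p + 1) q = 0" by (intro T_EH_zero[OF f]) auto
  then show "B_EH f p q = 0" by (simp add: B_EH_def op_B_zero)
qed

lemma B_EH_lincomb:
  assumes f: "f \<in> T_EH n" and g: "g \<in> T_EH n"
  shows "B_EH (f + EH_scale c g) = B_EH f + EH_scale c (B_EH g)"
proof (intro ext)
  fix p q X
  show "B_EH (f + EH_scale c g) p q X = (B_EH f + EH_scale c (B_EH g)) p q X"
    using op_B_lincomb[OF T_EHD[OF f, of "Suc p" q] T_EHD[OF g, of "Suc p" q], of c]
    by (simp add: B_EH_def EH_scale_apply)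
qed

text \<open>
  The Hochschild parts anticommute. The internal parts commute as operators, and become
  anticommuting through the sign \<open>(-1) ^ p\<close> in the differential, since \<open>B\<close> lowers \<open>p\<close> by one.
\<close>

theorem B_EH_d_EH:
  assumes f: "f \<in> T_EH n"
  shows "B_EH (d_EH f) = EH_scale (-1) (d_EH (B_EH f))"
proof (intro ext)
  fix p q X
  define \<beta> where "\<beta> = op_B p q (op_b (Suc p) q (f p q))"
  define \<beta>' where "\<beta>' = (if 0 < p then op_b p q (op_B (p - 1) q (f p q)) else 0)"
  have \<beta>: "\<beta> = - \<beta>'"
  proof (cases p)
    case 0
    then show ?thesis using op_B_op_b_0[OF T_EHD[OF f, of 0 q, simplified]] f
      by (auto simp: \<beta>_def \<beta>'_def op_B_op_b_0 T_EHD)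
  next
    case (Suc k)
    then have "\<beta>' + \<beta> = 0"
      using op_b_op_B_anticommute[of "f (Suc k) q" k q] T_EHD[OF f] by (simp add: \<beta>_def \<beta>'_def)
    then show ?thesis by (simp add: eq_neg_iff_add_eq_0 add.commute)
  qed
  show "B_EH (d_EH f) p q X = EH_scale (-1) (d_EH (B_EH f)) p q X"
  proof (cases q)
    case 0
    then show ?thesis using \<beta> by (simp add: B_EH_def d_EH_def EH_scale_apply \<beta>_def \<beta>'_def)
  next
    case (Suc r)
    have "B_EH (d_EH f) p q = op_B p q (op_b (Suc p) q (f p q)
        + (\<lambda>X. (-1) ^ Suc p * op_delta (Suc p) r (f (Suc p) r) X))"
      by (simp add: B_EH_def d_EH_def Suc)
    also have "\<dots> = \<beta> + (\<lambda>X. (-1) ^ Suc p * op_B p q (op_delta (Suc p) r (f (Suc p) r)) X)"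
      unfolding \<beta>_def Suc by (intro op_B_lincomb op_b_in_C op_delta_in_C T_EHD[OF f])
    also have "op_B p q (op_delta (Suc p) r (f (Suc p) r)) = op_delta p r (op_B p r (f (Suc p) r))"
      unfolding Suc by (intro op_B_op_delta T_EHD[OF f])
    finally show ?thesis
      using \<beta> by (simp add: Suc B_EH_def d_EH_def[of "\<lambda>p q. op_B p q (f (Suc p) q)"] EH_scale_apply \<beta>'_def)
  qed
qed

abbreviation "cob_EH n \<equiv> coboundaries T_EH d_EH n"

lemma EH_minus: "f - g = f + EH_scale (-1) g"
  by (simp add: fun_eq_iff EH_scale_apply)

lemma cob_EH_lincomb: "f \<in> cob_EH n \<Longrightarrow> g \<in> cob_EH n \<Longrightarrow> f + EH_scale c g \<in> cob_EH n"
  unfolding coboundaries_def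
proof (elim imageE)
  fix x y assume "f = d_EH x" "x \<in> T_EH (n - 1)" "g = d_EH y" "y \<in> T_EH (n - 1)"
  then show "f + EH_scale c g \<in> d_EH ` T_EH (n - 1)"
    using T_EH_lincomb[of x "n - 1" y c] d_EH_lincomb[of x "n - 1" y c] by (simp flip: d_EH_lincomb)
qed

lemma d_EH_zero: "d_EH 0 = 0"
  using d_EH_lincomb[OF zero_in_T_EH zero_in_T_EH, of "-1"] by (simp flip: EH_minus)

lemma zero_in_cob_EH: "0 \<in> cob_EH n"
  unfolding coboundaries_def using imageI[OF zero_in_T_EH, of d_EH] d_EH_zero by simp

lemma cob_EH_subgroup: "add_subgroup (cob_EH n)"
  by (simp add: add_subgroup_def zero_in_cob_EH EH_minus cob_EH_lincomb)

lemma cob_EH_scale: "f \<in> cob_EH n \<Longrightarrow> EH_scale c f \<in> cob_EH n"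
  using cob_EH_lincomb[OF zero_in_cob_EH, of f n c] by simp

lemma cob_EH_subset: "cob_EH n \<subseteq> T_EH n"
  unfolding coboundaries_def using d_EH_in_T_EH[of _ "n - 1"] by auto

lemma B_EH_cob:
  assumes "f \<in> cob_EH n" shows "B_EH f \<in> cob_EH (n - 1)"
proof -
  obtain g where g: "g \<in> T_EH (n - 1)" "f = d_EH g" using assms by (auto simp: coboundaries_def)
  have "d_EH (B_EH g) \<in> cob_EH (n - 1)"
    unfolding coboundaries_def using B_EH_in_T_EH[OF g(1)] by (intro imageI) simp
  then show ?thesis by (simp add: g(2) B_EH_d_EH[OF g(1)] cob_EH_scale)
qed

lemma B_EH_add: "f \<in> T_EH n \<Longrightarrow> g \<in> T_EH n \<Longrightarrow> B_EH (f + g) = B_EH f + B_EH g"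
  using B_EH_lincomb[of f n g 1] by (simp add: EH_scale_def)

lemma B_HH_coset:
  assumes "f \<in> T_EH n"
  shows "B_HH n (f +o cob_EH n) = B_EH f +o cob_EH (n - 1)"
  unfolding B_HH_def
  by (rule image_coset_plus[OF cob_EH_subgroup])
    (use B_EH_add[OF assms subsetD[OF cob_EH_subset]] B_EH_cob zero_in_cob_EH in auto)

lemma mem_ker_B_HH:
  "f +o cob_EH n \<in> ker_B_HH n" if "f \<in> cocycles T_EH d_EH n" "B_EH f \<in> cob_EH (n - 1)"
proof -
  have "f \<in> T_EH n" using that(1) by (simp add: cocycles_def)
  then show ?thesis
    using that coset_eq_iff[OF cob_EH_subgroup, of "B_EH f" "n - 1" 0]
    by (simp add: ker_B_HH_def B_HH_coset HH_def cohomology_def quot_def)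
qed

lemma ker_B_HHE:
  assumes "X \<in> ker_B_HH n"
  obtains f where "X = f +o cob_EH n" "f \<in> cocycles T_EH d_EH n" "B_EH f \<in> cob_EH (n - 1)"
proof -
  obtain f where f: "X = f +o cob_EH n" "f \<in> cocycles T_EH d_EH n"
    using assms by (auto simp: ker_B_HH_def HH_def cohomology_def quot_def)
  then have "f \<in> T_EH n" by (simp add: cocycles_def)
  then have "B_EH f +o cob_EH (n - 1) = cob_EH (n - 1)"
    using assms f by (simp add: ker_B_HH_def B_HH_coset)
  then have "B_EH f \<in> cob_EH (n - 1)"
    using coset_eq_iff[OF cob_EH_subgroup, of "B_EH f" "n - 1" 0] by simp
  then show ?thesis using f that by blast
qed


subsection \<open>The cyclic complex by columns\<close>

text \<open>
  The column of filtration degree \<open>p\<close> of the tricomplex is a copy of the Hochschild complex,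
  shifted by \<open>2 p\<close>, and the differential of the total complex is the Hochschild differential
  in each column plus \<open>B\<close> from one column to the next.
\<close>

definition column :: "nat \<Rightarrow> (nat \<Rightarrow> nat \<Rightarrow> nat \<Rightarrow> ('k, 'a) cochain) \<Rightarrow> nat \<Rightarrow> nat \<Rightarrow> ('k, 'a) cochain" where
  "column p f = (\<lambda>a r. f p (p + a) r)"

lemma mem_T_EC_iff:
  "f \<in> T_EC n \<longleftrightarrow> (\<forall>p. column p f \<in> T_EH (n - 2 * int p)) \<and> (\<forall>p q r. q < p \<longrightarrow> f p q r = 0)"
proof
  assume f: "f \<in> T_EC n"
  have "column p f \<in> T_EH (n - 2 * int p)" for p
    unfolding T_EH_def
  proof (intro CollectI allI conjI impI)
    fix a r
    have "f p (p + a) r \<in> EC p (p + a) r" using f by (simp add: T_EC_def)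
    then show "column p f a r \<in> C a r" by (simp add: column_def EC_def)
    assume "int (a + r) \<noteq> n - 2 * int p"
    then have "int (p + (p + a) + r) \<noteq> n" by auto
    then show "column p f a r = 0" using f by (simp add: T_EC_def column_def)
  qed
  moreover have "f p q r = 0" if "q < p" for p q r
  proof -
    have "f p q r \<in> EC p q r" using f by (simp add: T_EC_def)
    then show ?thesis using that by (simp add: EC_def)
  qed
  ultimately show "(\<forall>p. column p f \<in> T_EH (n - 2 * int p)) \<and> (\<forall>p q r. q < p \<longrightarrow> f p q r = 0)"
    by blast
next
  assume f: "(\<forall>p. column p f \<in> T_EH (n - 2 * int p)) \<and> (\<forall>p q r. q < p \<longrightarrow> f p q r = 0)"
  have "f p q r \<in> EC p q r \<and> (int (p + q + r) \<noteq> n \<longrightarrow> f p q r = 0)" for p q r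
  proof (cases "q < p")
    case False
    have c: "column p f (q - p) r = f p q r" using False by (simp add: column_def)
    have "column p f \<in> T_EH (n - 2 * int p)" using f by blast
    from T_EHD[OF this, of "q - p" r] T_EH_zero[OF this, of "q - p" r] show ?thesis
      unfolding c using False by (auto simp: EC_def)
  qed (use f in \<open>simp add: EC_def\<close>)
  then show "f \<in> T_EC n" by (simp add: T_EC_def)
qed

lemma column_d_EC:
  "column p (d_EC f) = d_EH (column p f) + (if p = 0 then 0 else B_EH (column (p - 1) f))"
  by (cases p) (auto simp: fun_eq_iff column_def d_EC_def d_EH_def B_EH_def)

lemma d_EC_below: "q < p \<Longrightarrow> d_EC f p q r = 0"
  by (simp add: d_EC_def)

lemma column_lincomb: "column p (f + EC_scale c g) = column p f + EH_scale c (column p g)"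
  by (simp add: column_def EC_scale_def EH_scale_def fun_eq_iff)

lemma column_zero: "column p 0 = 0"
  by (simp add: column_def fun_eq_iff)

lemma EC_eqI:
  assumes "\<And>p. column p f = column p g" "\<And>p q r. q < p \<Longrightarrow> f p q r = g p q r"
  shows "f = g"
proof (intro ext)
  fix p q r X
  show "f p q r X = g p q r X"
  proof (cases "q < p")
    case False
    then show ?thesis using fun_cong[OF fun_cong[OF assms(1)[of p], of "q - p"], of r]
      by (simp add: column_def)
  qed (simp add: assms(2))
qed

lemma T_EC_column: "f \<in> T_EC n \<Longrightarrow> column p f \<in> T_EH (n - 2 * int p)"
  by (simp add: mem_T_EC_iff)

lemma zero_in_T_EC: "0 \<in> T_EC n"
  by (simp add: mem_T_EC_iff column_zero zero_in_T_EH)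

lemma T_EC_lincomb: "f \<in> T_EC n \<Longrightarrow> g \<in> T_EC n \<Longrightarrow> f + EC_scale c g \<in> T_EC n"
  by (auto simp: mem_T_EC_iff column_lincomb T_EH_lincomb) (simp add: EC_scale_def fun_eq_iff)

lemma d_EC_in_T_EC:
  assumes f: "f \<in> T_EC n" shows "d_EC f \<in> T_EC (n + 1)"
proof -
  have "column p (d_EC f) \<in> T_EH (n + 1 - 2 * int p)" for p
  proof -
    have 1: "d_EH (column p f) \<in> T_EH (n + 1 - 2 * int p)"
      using d_EH_in_T_EH[OF T_EC_column[OF f, of p]] by (simp add: algebra_simps)
    have "B_EH (column (p - 1) f) \<in> T_EH (n + 1 - 2 * int p)" if "p \<noteq> 0"
      using B_EH_in_T_EH[OF T_EC_column[OF f, of "p - 1"]] that by (simp add: of_nat_diff algebra_simps)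
    then have "(if p = 0 then 0 else B_EH (column (p - 1) f)) \<in> T_EH (n + 1 - 2 * int p)"
      using zero_in_T_EH by auto
    from T_EH_lincomb[OF 1 this, of 1] show ?thesis by (simp add: column_d_EC EH_scale_def)
  qed
  then show ?thesis by (simp add: mem_T_EC_iff d_EC_below)
qed

lemma d_EC_lincomb:
  assumes f: "f \<in> T_EC n" and g: "g \<in> T_EC n"
  shows "d_EC (f + EC_scale c g) = d_EC f + EC_scale c (d_EC g)"
proof (rule EC_eqI)
  fix p
  show "column p (d_EC (f + EC_scale c g)) = column p (d_EC f + EC_scale c (d_EC g))"
    unfolding column_d_EC column_lincomb
    by (simp add: d_EH_lincomb[OF T_EC_column[OF f] T_EC_column[OF g]]
        B_EH_lincomb[OF T_EC_column[OF f] T_EC_column[OF g]])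
      (simp add: EH_scale_def fun_eq_iff algebra_simps)
qed (simp add: d_EC_below EC_scale_def fun_eq_iff)

abbreviation "cob_EC n \<equiv> coboundaries T_EC d_EC n"

lemma EC_minus: "f - g = f + EC_scale (-1) g"
  by (simp add: fun_eq_iff EC_scale_def)

lemma d_EC_diff: "f \<in> T_EC n \<Longrightarrow> g \<in> T_EC n \<Longrightarrow> d_EC (f - g) = d_EC f - d_EC g"
  by (simp add: EC_minus d_EC_lincomb)

lemma d_EC_zero: "d_EC 0 = 0"
  using d_EC_diff[OF zero_in_T_EC zero_in_T_EC] by simp

lemma cob_EC_lincomb: "f \<in> cob_EC n \<Longrightarrow> g \<in> cob_EC n \<Longrightarrow> f + EC_scale c g \<in> cob_EC n"
  unfolding coboundaries_def
proof (elim imageE)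
  fix x y assume "f = d_EC x" "x \<in> T_EC (n - 1)" "g = d_EC y" "y \<in> T_EC (n - 1)"
  then show "f + EC_scale c g \<in> d_EC ` T_EC (n - 1)"
    using T_EC_lincomb[of x "n - 1" y c] d_EC_lincomb[of x "n - 1" y c] by (simp flip: d_EC_lincomb)
qed

lemma zero_in_cob_EC: "0 \<in> cob_EC n"
  unfolding coboundaries_def using imageI[OF zero_in_T_EC, of d_EC] d_EC_zero by simp

lemma cob_EC_subgroup: "add_subgroup (cob_EC n)"
  by (simp add: add_subgroup_def zero_in_cob_EC EC_minus cob_EC_lincomb)

lemma cob_EC_scale: "f \<in> cob_EC n \<Longrightarrow> EC_scale c f \<in> cob_EC n"
  using cob_EC_lincomb[OF zero_in_cob_EC, of f n c] by simp

lemma mem_F1_iff: "f \<in> F1 s n \<longleftrightarrow> f \<in> T_EC n \<and> (\<forall>p. int p < s \<longrightarrow> column p f = 0)"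
proof
  assume "f \<in> F1 s n"
  then show "f \<in> T_EC n \<and> (\<forall>p. int p < s \<longrightarrow> column p f = 0)"
    by (auto simp: F1_def column_def fun_eq_iff)
next
  assume f: "f \<in> T_EC n \<and> (\<forall>p. int p < s \<longrightarrow> column p f = 0)"
  have "f p q r = 0" if "int p < s" for p q r
  proof (cases "q < p")
    case True
    then show ?thesis using f by (simp add: mem_T_EC_iff)
  next
    case False
    have "column p f (q - p) r = 0" using f that by simp
    then show ?thesis using False by (simp add: column_def)
  qed
  then show "f \<in> F1 s n" using f by (simp add: F1_def)
qed

lemma F1_subgroup: "add_subgroup (F1 s n)"
  by (auto simp: add_subgroup_def mem_F1_iff zero_in_T_EC column_zero EC_minus T_EC_lincomb
      column_lincomb) (simp add: EH_scale_def fun_eq_iff)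

text \<open>
  A nonzero component in filtration degree \<open>p\<close> has total degree at least \<open>p\<close>.
\<close>

lemma F1_eq_0:
  assumes f: "f \<in> F1 s n" and "n < s"
  shows "f = 0"
proof (intro ext)
  fix p q r X
  show "f p q r X = 0 p q r X"
  proof (cases "int p < s")
    case False
    then have "int (p + q + r) \<noteq> n" using assms(2) by auto
    then show ?thesis using f by (simp add: F1_def T_EC_def)
  qed (use f in \<open>simp add: F1_def\<close>)
qed


section \<open>From cyclic to Hochschild cohomology\<close>

text \<open>
  Projection to the column \<open>p = 0\<close> is a chain map. On a cocycle the component of the
  equation \<open>d f = 0\<close> in the column \<open>p = 1\<close> exhibits \<open>B\<close> of the projection as a coboundary.
\<close>

lemma column_0_cob: "f \<in> cob_EC n \<Longrightarrow> column 0 f \<in> cob_EH n"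
  unfolding coboundaries_def using T_EC_column[of _ "n - 1" 0] by (auto simp: column_d_EC)

lemma column_0_cocycle:
  assumes f: "f \<in> cocycles T_EC d_EC n"
  shows "column 0 f \<in> cocycles T_EH d_EH n" and "B_EH (column 0 f) \<in> cob_EH (n - 1)"
proof -
  have T: "f \<in> T_EC n" and d: "d_EC f = 0" using f by (simp_all add: cocycles_def)
  show "column 0 f \<in> cocycles T_EH d_EH n"
    using T_EC_column[OF T, of 0] column_d_EC[of 0 f] by (simp add: d column_zero cocycles_def)
  have c1: "column 1 f \<in> T_EH (n - 1 - 1)" using T_EC_column[OF T, of 1] by (simp add: algebra_simps)
  have "d_EH (column 1 f) + B_EH (column 0 f) = 0"
    using column_d_EC[of 1 f] by (simp add: d column_zero)
  then have "B_EH (column 0 f) = 0 - d_EH (column 1 f)" by (simp add: eq_neg_iff_add_eq_0 add.commute)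
  moreover have "d_EH (column 1 f) \<in> cob_EH (n - 1)" using c1 by (auto simp: coboundaries_def)
  ultimately show "B_EH (column 0 f) \<in> cob_EH (n - 1)"
    using add_subgroupD(2)[OF cob_EH_subgroup zero_in_cob_EH] by simp
qed

text \<open>
  A Hochschild cocycle \<open>f\<close> with \<open>B f = d g\<close> gives the element \<open>f - g\<close> with components in
  the first two columns, whose differential has filtration degree \<open>2\<close>. It survives to all
  later pages by degeneration. The filtration is finite in each degree, so that the
  element is eventually corrected, within filtration degree \<open>1\<close>, to a cocycle.
\<close>

lemma extend_to_cocycle:
  assumes deg: "ss_degenerates_at F1 d_EC 2"
    and f: "f \<in> cocycles T_EH d_EH n" and Bf: "B_EH f \<in> cob_EH (n - 1)"
  shows "\<exists>h \<in> cocycles T_EC d_EC n. column 0 h = f"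
proof -
  obtain g where g: "g \<in> T_EH (n - 2)" "B_EH f = d_EH g" using Bf by (auto simp: coboundaries_def)
  have fT: "f \<in> T_EH n" and df: "d_EH f = 0" using f by (simp_all add: cocycles_def)
  let ?g = "0 + EH_scale (-1) g"
  have g': "?g \<in> T_EH (n - 2)" "d_EH ?g + B_EH f = 0"
    using T_EH_lincomb[OF zero_in_T_EH g(1)] d_EH_lincomb[OF zero_in_T_EH g(1), of "-1"] g(2)
    by (auto simp: d_EH_zero fun_eq_iff EH_scale_apply)
  \<comment> \<open>In the column \<open>p = 1\<close>, the Hochschild degree is \<open>q - 1\<close>, which explains the shift of \<open>g\<close>.\<close>
  define x where "x p q r = (if p = 0 then f q r else if p = 1 \<and> 1 \<le> q then ?g (q - 1) r else 0)"
    for p q r :: nat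
  have col: "column p x = (if p = 0 then f else if p = 1 then ?g else 0)" for p
    by (auto simp: column_def x_def fun_eq_iff)
  have xT: "x \<in> T_EC n"
    using fT g'(1) zero_in_T_EH by (auto simp: mem_T_EC_iff col) (auto simp: x_def)
  have "column p (d_EC x) = 0" if "int p < 2" for p
  proof -
    have "p = 0 \<or> p = 1" using that by auto
    then show ?thesis using df g'(2) by (auto simp: column_d_EC col)
  qed
  then have "x \<in> ss_Z F1 d_EC 2 0 n"
    using xT d_EC_in_T_EC[OF xT] by (simp add: ss_Z_def mem_F1_iff)
  from ss_lift[OF F1_subgroup _ _ d_EC_zero deg this, of "nat n"]
  obtain h where h: "h \<in> ss_Z F1 d_EC (2 + int (nat n)) 0 n" "x - h \<in> F1 (0 + 1) n"
    using d_EC_diff by (force simp: mem_F1_iff)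
  have "h \<in> T_EC n" using h(1) by (simp add: ss_Z_def mem_F1_iff)
  moreover have "d_EC h = 0"
    by (rule F1_eq_0[of _ "2 + int (nat n)" "n + 1"]) (use h(1) in \<open>auto simp: ss_Z_def\<close>)
  moreover have "column 0 h = f"
  proof -
    have "column 0 (x - h) = 0" using h(2) by (simp add: mem_F1_iff)
    then show ?thesis using col[of 0] by (simp add: column_def fun_eq_iff)
  qed
  ultimately show ?thesis by (auto simp: cocycles_def)
qed

theorem HC_onto_ker_B_HH:
  assumes deg: "ss_degenerates_at F1 d_EC 2"
  shows "\<exists>S. quot_linear EC_scale (cob_EC n) (HC n) EH_scale (cob_EH n) (ker_B_HH n) S \<and>
    S ` HC n = ker_B_HH n"
proof -
  define S where "S X = column 0 ` X + cob_EH n" for X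
  have S: "S (x +o cob_EC n) = column 0 x +o cob_EH n" for x
    unfolding S_def
    by (rule image_coset_plus[OF cob_EH_subgroup _ column_0_cob zero_in_cob_EC])
      (auto simp: column_def fun_eq_iff)
  have HCE: "\<exists>x. X = x +o cob_EC n \<and> x \<in> cocycles T_EC d_EC n" if "X \<in> HC n" for X
    using that by (auto simp: HC_def cohomology_def quot_def)
  have into: "S X \<in> ker_B_HH n" if X: "X \<in> HC n" for X
    using HCE[OF X] column_0_cocycle by (auto simp: S intro!: mem_ker_B_HH)
  have "quot_linear EC_scale (cob_EC n) (HC n) EH_scale (cob_EH n) (ker_B_HH n) S"
    unfolding quot_linear_def
  proof (intro conjI ballI allI into)
    fix X Y c assume X: "X \<in> HC n"
    obtain x where x: "X = x +o cob_EC n" using HCE[OF X] by blast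
    have "quot_scale EC_scale (cob_EC n) c X = EC_scale c x +o cob_EC n"
      unfolding x by (rule quot_scale_coset[OF cob_EC_subgroup _ cob_EC_scale])
        (simp_all add: EC_scale_def fun_eq_iff algebra_simps)
    moreover have "quot_scale EH_scale (cob_EH n) c (S X) = EH_scale c (column 0 x) +o cob_EH n"
      unfolding x S by (rule quot_scale_coset[OF cob_EH_subgroup _ cob_EH_scale])
        (simp_all add: EH_scale_def fun_eq_iff algebra_simps)
    ultimately show "S (quot_scale EC_scale (cob_EC n) c X) = quot_scale EH_scale (cob_EH n) c (S X)"
      by (simp add: S column_def EC_scale_def EH_scale_def)
    assume Y: "Y \<in> HC n"
    obtain y where y: "Y = y +o cob_EC n" using HCE[OF Y] by blast
    have "column 0 (x + y) = column 0 x + column 0 y" by (simp add: column_def fun_eq_iff)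
    then show "S (X + Y) = S X + S Y"
      by (simp add: x y S coset_plus[OF cob_EC_subgroup] coset_plus[OF cob_EH_subgroup])
  qed
  moreover have "ker_B_HH n \<subseteq> S ` HC n"
  proof
    fix Y assume "Y \<in> ker_B_HH n"
    then obtain f where f: "Y = f +o cob_EH n" "f \<in> cocycles T_EH d_EH n" "B_EH f \<in> cob_EH (n - 1)"
      by (rule ker_B_HHE)
    obtain h where h: "h \<in> cocycles T_EC d_EC n" "column 0 h = f"
      using extend_to_cocycle[OF deg f(2,3)] by blast
    have "h +o cob_EC n \<in> HC n" using h(1) by (simp add: HC_def cohomology_def quot_def)
    then show "Y \<in> S ` HC n" using S[of h] h(2) f(1) by force
  qed
  ultimately show ?thesis using into by (intro exI[of _ S]) auto
qed

end

theorem proposition4p11: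
  fixes scale :: "'k::field_char_0 \<Rightarrow> 'a::{ring, monoid_mult} \<Rightarrow> 'a"
    and A :: "nat \<Rightarrow> 'a set" and \<phi> :: "'a \<Rightarrow> 'a" and n :: int
  assumes "dga scale A \<phi>"
    and "ss_degenerates_at (dga.F1 scale A) (dga.d_EC scale A \<phi>) 2"
    and "n \<ge> 1"
  shows "\<exists>S.
    quot_linear
      dga.EC_scale (coboundaries (dga.T_EC scale A) (dga.d_EC scale A \<phi>) n) (dga.HC scale A \<phi> n)
      dga.EH_scale (coboundaries (dga.T_EH scale A) (dga.d_EH scale A \<phi>) n) (dga.ker_B_HH scale A \<phi> n) S
    \<and> S ` dga.HC scale A \<phi> n = dga.ker_B_HH scale A \<phi> n"
  by (rule dga.HC_onto_ker_B_HH[OF assms(1,2)])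

end
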